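(* For every prime power $q\ge 4$ there exists a set of $q^2-q$ points of $\mathrm{AG}(5,q)$ that is both a $4$-general set and a $(5,3)$-set.
   Context: For integers $r,s$, an $(r,s)$-set of $\mathrm{PG}(n,q)$ is a set $\mathcal X$ of points such that: (i) every $s$-dimensional projective subspace contains at most $r$ points of $\mathcal X$; (ii) $\mathcal X$ spans $\mathrm{PG}(n,q)$; (iii) some $(s+1)$-dimensional projective subspace contains $r+2$ points of $\mathcal X$. A $k$-general set is a $(k-1,k-2)$-set (so a $4$-general set is a $(3,2)$-set). A set of points of $\mathrm{AG}(n,q)$ is called an $(r,s)$-set (resp. $k$-general set) of $\mathrm{AG}(n,q)$ if, regarded as a subset of $\mathrm{PG}(n,q)=\mathrm{AG}(n,q)\cup H_\infty$ ($H_\infty$ the hyperplane at infinity), it is an $(r,s)$-set (resp. $k$-general set) of $\mathrm{PG}(n,q)$. *)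

theory Defs
  imports "HOL-Analysis.Analysis"
begin

text \<open>PG(n,q) is modelled on the vector space F^(n+1) = 'a ^ 'n over a finite field 'a,
  with CARD('n) = n+1. A projective point is a 1-dimensional linear subspace;
  a projective subspace of (projective) dimension s is a linear subspace of vector
  dimension s+1. A point P lies in a subspace W iff P is contained in W.\<close>

definition proj_points :: "('a::field ^ 'n) set set" where
  "proj_points = {P. vec.subspace P \<and> vec.dim P = 1}"

definition proj_subspaces :: "nat \<Rightarrow> ('a::field ^ 'n) set set" where
  "proj_subspaces s = {W. vec.subspace W \<and> vec.dim W = s + 1}"

definition points_in :: "('a::field ^ 'n) set set \<Rightarrow> ('a ^ 'n) set \<Rightarrow> nat" where
  "points_in X W = card {P \<in> X. P \<subseteq> W}"

definition rs_set :: "nat \<Rightarrow> nat \<Rightarrow> ('a::field ^ 'n) set set \<Rightarrow> bool" where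
  "rs_set r s X \<longleftrightarrow>
     X \<subseteq> proj_points \<and>
     (\<forall>W \<in> proj_subspaces s. points_in X W \<le> r) \<and>
     vec.span (\<Union>X) = UNIV \<and>
     (\<exists>W \<in> proj_subspaces (s + 1). points_in X W \<ge> r + 2)"

definition k_general :: "nat \<Rightarrow> ('a::field ^ 'n) set set \<Rightarrow> bool" where
  "k_general k X \<longleftrightarrow> rs_set (k - 1) (k - 2) X"

text \<open>AG(n,q) = PG(n,q) minus the hyperplane at infinity H_inf = {x. x $ 0 = 0}.
  A set of points of AG(n,q) is a set of projective points none of which lies in H_inf.\<close>
definition hyperplane_at_infinity :: "('a::field ^ 'n::{finite,zero}) set" where
  "hyperplane_at_infinity = {v. v $ 0 = 0}"

definition affine_point_set :: "('a::field ^ 'n::{finite,zero}) set set \<Rightarrow> bool" where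
  "affine_point_set X \<longleftrightarrow> X \<subseteq> proj_points \<and> (\<forall>P \<in> X. \<not> P \<subseteq> hyperplane_at_infinity)"

end

theory Submission
  imports Defs "HOL-Algebra.Algebraic_Closure_Type"
begin

text \<open>
  Let \<open>s\<close> be the \<open>q\<close>-Frobenius on the algebraic closure of \<open>F\<^sub>q\<close> and \<open>Y\<close> the set of solutions of
  \<open>y * s (s y) = s y + 1\<close>. This is a separable equation of degree \<open>q\<^sup>2 + 1\<close>, and iterating it
  (the pentagon recurrence) gives \<open>s\<^sup>5 y = y\<close>, so \<open>Y\<close> lies in the field of order \<open>q\<^sup>5\<close>, a copy of
  \<open>AG(5,q)\<close>. (Geometrically, \<open>Y\<close> is a del Pezzo surface of degree 5 minus a pentagon of lines.)

  If \<open>p\<close>, \<open>p + d\<^sub>k\<close> and \<open>p + \<Sum> x\<^sub>k d\<^sub>k\<close> lie in \<open>Y\<close> with \<open>x\<^sub>k \<in> F\<^sub>q\<close>, then the symmetric form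
  \<open>L\<^sub>x(u,v) = (u \<cdot> x) (v \<cdot> x) - \<Sum> x\<^sub>k u\<^sub>k v\<^sub>k\<close> vanishes on the pairs \<open>(s\<^sup>i d, s\<^sup>i\<^sup>+\<^sup>2 d)\<close>. By the
  nonvanishing of Moore determinants this forces \<open>L\<^sub>x = 0\<close> for two chords, so no four points of \<open>Y\<close>
  are coplanar, and it makes \<open>L\<^sub>x\<close> unique up to a factor for three chords, so no six points lie
  in a solid. Solids with five and hyperplanes with seven points exist by the pigeonhole principle.
  A hyperplane meets \<open>Y\<close> in the roots of a polynomial of degree at most \<open>2 q + 1 < q\<^sup>2 - q\<close>,
  so every subset of \<open>Y\<close> of size \<open>q\<^sup>2 - q\<close> containing such seven points will do.
\<close>

(* Otherwise "X" would be a keyword and "$" ambiguous. *)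
no_notation Polynomials.var (\<open>X\<index>\<close>)
unbundle no Formal_Power_Series.fps_syntax

subsection \<open>Points on the pentagon variety of a field endomorphism\<close>

locale field_endomorphism =
  fixes s :: "'k::field \<Rightarrow> 'k"
  assumes s_add: "s (x + y) = s x + s y"
    and s_mult: "s (x * y) = s x * s y"
    and s_1: "s 1 = 1"
begin

lemma s_0: "s 0 = 0"
  using s_add[of 0 0] by (metis add_cancel_right_left)

lemma s_minus: "s (- x) = - s x"
  using s_add[of x "- x"] by (simp add: s_0 eq_neg_iff_add_eq_0 add.commute)

lemma s_diff: "s (x - y) = s x - s y"
  using s_add[of x "- y"] by (simp add: s_minus)

lemma s_eq_0_iff [simp]: "s x = 0 \<longleftrightarrow> x = 0"
proof
  assume "s x = 0"
  show "x = 0"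
  proof (rule ccontr)
    assume "x \<noteq> 0"
    then have "s x * s (inverse x) = 1"
      by (simp add: s_1 flip: s_mult)
    with \<open>s x = 0\<close> show False by simp
  qed
qed (simp add: s_0)

lemma s_inverse: "s (inverse x) = inverse (s x)"
proof (cases "x = 0")
  case False
  then have "s x * s (inverse x) = 1"
    by (simp add: s_1 flip: s_mult)
  then show ?thesis by (metis inverse_unique)
qed (simp add: s_0)

lemma s_divide: "s (x / y) = s x / s y"
  by (simp add: divide_inverse s_mult s_inverse)

lemmas s_hom = s_add s_mult s_1 s_0 s_minus s_diff s_divide

section \<open>Linear independence over the fixed field of \<open>s\<close> and Moore
  determinants\<close>

definition indep2 :: "'k \<Rightarrow> 'k \<Rightarrow> bool" where
  "indep2 d e \<longleftrightarrow> (\<forall>a b. s a = a \<longrightarrow> s b = b \<longrightarrow> a * d + b * e = 0 \<longrightarrow> a = 0 \<and> b = 0)"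

definition indep3 :: "'k \<Rightarrow> 'k \<Rightarrow> 'k \<Rightarrow> bool" where
  "indep3 d e f \<longleftrightarrow> (\<forall>a b c. s a = a \<longrightarrow> s b = b \<longrightarrow> s c = c \<longrightarrow>
     a * d + b * e + c * f = 0 \<longrightarrow> a = 0 \<and> b = 0 \<and> c = 0)"

lemma indep2_s:
  assumes "indep2 d e"
  shows "indep2 (s d) (s e)"
  unfolding indep2_def
proof (intro allI impI)
  fix a b assume ab: "s a = a" "s b = b" "a * s d + b * s e = 0"
  then have "s (a * d + b * e) = 0" by (simp add: s_add s_mult)
  then have "a * d + b * e = 0" by simp
  then show "a = 0 \<and> b = 0" using assms ab by (simp add: indep2_def)
qed

lemma indep3_s:
  assumes "indep3 d e f"
  shows "indep3 (s d) (s e) (s f)"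
  unfolding indep3_def
proof (intro allI impI)
  fix a b c assume ab: "s a = a" "s b = b" "s c = c" "a * s d + b * s e + c * s f = 0"
  then have "s (a * d + b * e + c * f) = 0" by (simp add: s_add s_mult)
  then have "a * d + b * e + c * f = 0" by simp
  then show "a = 0 \<and> b = 0 \<and> c = 0" using assms ab by (simp add: indep3_def)
qed

lemma indep3_imp_indep2:
  assumes "indep3 d e f"
  shows "indep2 d e" "indep2 d f" "indep2 e f"
proof -
  show "indep2 d e" unfolding indep2_def
    using assms[unfolded indep3_def, rule_format, where c = 0] by (simp add: s_0)
  show "indep2 d f" unfolding indep2_def
    using assms[unfolded indep3_def, rule_format, where b = 0] by (simp add: s_0)
  show "indep2 e f" unfolding indep2_def
    using assms[unfolded indep3_def, rule_format, where a = 0] by (simp add: s_0)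
qed

text \<open>Moore determinants of independent elements do not vanish: normalising a coefficient
  of a relation to 1 and subtracting the relation from its image under \<open>s\<close> shortens it.\<close>

lemma moore2:
  assumes ind: "indep2 d e"
    and 0: "g * d + h * e = 0" and 1: "g * s d + h * s e = 0"
  shows "g = 0 \<and> h = 0"
proof -
  have d: "d \<noteq> 0"
    using ind[unfolded indep2_def, rule_format, of 1 0] by (auto simp: s_1 s_0)
  have "h = 0"
  proof (rule ccontr)
    assume h: "h \<noteq> 0"
    define k where "k = g / h"
    have e: "e = - k * d" using 0 h by (simp add: k_def field_simps eq_neg_iff_add_eq_0)
    have "s e = - k * s d" using 1 h by (simp add: k_def field_simps eq_neg_iff_add_eq_0)
    moreover have "s e = - s k * s d" by (simp add: e s_hom)
    ultimately have "s k = k" using d by simp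
    then show False
      using ind[unfolded indep2_def, rule_format, of k 1] e by (simp add: s_1)
  qed
  with 0 d show ?thesis by simp
qed

lemma moore3:
  assumes ind: "indep3 d e f"
    and 0: "g * d + h * e + k * f = 0"
    and 1: "g * s d + h * s e + k * s f = 0"
    and 2: "g * s (s d) + h * s (s e) + k * s (s f) = 0"
  shows "g = 0 \<and> h = 0 \<and> k = 0"
proof -
  have k: "k = 0"
  proof (rule ccontr)
    assume k: "k \<noteq> 0"
    define a b where "a = g / k" and "b = h / k"
    have f: "f = - a * d - b * e"
      using 0 k by (simp add: a_def b_def field_simps) (metis add_eq_0_iff add.commute)
    have f1: "s f = - a * s d - b * s e"
      using 1 k by (simp add: a_def b_def field_simps) (metis add_eq_0_iff add.commute)
    have f2: "s (s f) = - a * s (s d) - b * s (s e)"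
      using 2 k by (simp add: a_def b_def field_simps) (metis add_eq_0_iff add.commute)
    have "(s a - a) * s d + (s b - b) * s e = 0"
      using arg_cong[OF f, of s] f1 by (simp add: s_hom algebra_simps)
    moreover have "(s a - a) * s (s d) + (s b - b) * s (s e) = 0"
      using arg_cong[OF f1, of s] f2 by (simp add: s_hom algebra_simps)
    ultimately have "s a - a = 0 \<and> s b - b = 0"
      using moore2[OF indep2_s] indep3_imp_indep2(1)[OF ind] by blast
    then have "s a = a" "s b = b" by auto
    then show False
      using ind[unfolded indep3_def, rule_format, of a b 1] f by (simp add: s_1)
  qed
  have "g = 0 \<and> h = 0"
    by (rule moore2[OF indep3_imp_indep2(1)[OF ind]]) (use 0 1 k in auto)
  with k show ?thesis by simp
qed

text \<open>The \<open>s\<close>-orbit of such a \<open>y\<close> satisfies the recurrence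
  \<open>x (n + 2) = (x (n + 1) + 1) / x n\<close> of Gauss and Lyness, which has period 5.\<close>

definition pentagon :: "'k set" where
  "pentagon = {y. y * s (s y) = s y + 1}"

lemma pentagonD: "y \<in> pentagon \<Longrightarrow> y * s (s y) = s y + 1"
  by (simp add: pentagon_def)

lemma pentagon_nonzero: "y \<in> pentagon \<Longrightarrow> y \<noteq> 0"
  by (auto simp: pentagon_def s_0)

lemma s_pentagon: "y \<in> pentagon \<Longrightarrow> s y \<in> pentagon"
  using s_add[of "s y" 1] s_mult[of y "s (s y)"] by (simp add: pentagon_def s_1)

text \<open>Period 5 puts every point into the fixed field of the fifth iterate of \<open>s\<close>.
  The other two identities express the fourth and third iterates through \<open>y\<close> and
  \<open>s y\<close>; they clear denominators in hyperplane sections.\<close>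

lemma pentagon_orbit:
  assumes y: "y \<in> pentagon"
  shows "s y * (s (s (s (s y)))) = y + 1"
    and "y * s y * s (s (s y)) = y + s y + 1"
    and "s (s (s (s (s y)))) = y"
proof -
  define a b c d e f where "a = y" and "b = s a" and "c = s b" and "d = s c" and "e = s d"
    and "f = s e"
  have nz: "a \<noteq> 0" "b \<noteq> 0" "c \<noteq> 0" "d \<noteq> 0" "e \<noteq> 0"
    using pentagon_nonzero[OF y] by (simp_all add: a_def b_def c_def d_def e_def)
  have 1: "a * c = b + 1" "b * d = c + 1" "c * e = d + 1" "d * f = e + 1"
    using pentagonD[OF y] pentagonD[OF s_pentagon[OF y]]
      pentagonD[OF s_pentagon[OF s_pentagon[OF y]]]
      pentagonD[OF s_pentagon[OF s_pentagon[OF s_pentagon[OF y]]]]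
    by (simp_all add: a_def b_def c_def d_def e_def f_def)
  have 2: "a * b * d = a + b + 1"
    using 1(1,2) by Groebner_Basis.algebra
  \<comment> \<open>\<open>b * c * e = b * d + b = c + (b + 1) = c + a * c\<close>. The new unknown
    occurs only with the factor \<open>c\<close>, which cancels because no orbit element vanishes;
    the cancellation of \<open>b\<close> below is analogous.\<close>
  have "c * (b * e) = c * (a + 1)" using 1 2 by Groebner_Basis.algebra
  then have 3: "b * e = a + 1" using nz by simp
  have "b * (d * f) = b * (d * a)" using 1 2 3 by Groebner_Basis.algebra
  then have 4: "f = a" using nz by simp
  show "s y * (s (s (s (s y)))) = y + 1" "y * s y * s (s (s y)) = y + s y + 1"
    "s (s (s (s (s y)))) = y"
    using 2 3 4 by (simp_all add: a_def b_def c_def d_def e_def f_def)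
qed

section \<open>Chords: no three points collinear, no four coplanar\<close>

lemma s5_diff:
  assumes "y \<in> pentagon" "z \<in> pentagon"
  shows "s (s (s (s (s (z - y))))) = z - y"
  using assms by (simp add: s_diff pentagon_orbit(3))

text \<open>Subtracting the equations of \<open>p\<close> and \<open>p + w\<close> makes
  \<open>w * s (s w)\<close> equal to an expression that is linear in \<open>w\<close> over the
  fixed field. So for chords \<open>w\<close> this quadratic expression respects linear combinations
  that are again chords.\<close>

lemma chord_relation:
  assumes "p \<in> pentagon" "p + d \<in> pentagon" "p + e \<in> pentagon" "p + f \<in> pentagon"
    and "p + (x * d + y * e + z * f) \<in> pentagon"
    and "s x = x" "s y = y" "s z = z"
  shows "(x * d + y * e + z * f) * s (s (x * d + y * e + z * f))
       = x * (d * s (s d)) + y * (e * s (s e)) + z * (f * s (s f))"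
proof -
  have chord: "w * s (s w) = s w - p * s (s w) - w * s (s p)" if "p + w \<in> pentagon" for w
    using pentagonD[OF assms(1)] pentagonD[OF that]
    by (simp add: s_add algebra_simps)
  show ?thesis
    unfolding chord[OF assms(2)] chord[OF assms(3)] chord[OF assms(4)] chord[OF assms(5)]
    by (simp add: s_add s_mult assms(6-8) algebra_simps)
qed


lemma pentagon_indep2:
  assumes "p \<in> pentagon" "q \<in> pentagon" "r \<in> pentagon" and dist: "distinct [p, q, r]"
  shows "indep2 (q - p) (r - p)"
  unfolding indep2_def
proof (intro allI impI)
  fix a b assume ab: "s a = a" "s b = b" "a * (q - p) + b * (r - p) = 0"
  define d where "d = q - p"
  have d: "d \<noteq> 0" "r - p \<noteq> 0" "r - p \<noteq> d" using dist by (auto simp: d_def)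
  show "a = 0 \<and> b = 0"
  proof (cases "b = 0")
    case True
    with ab d show ?thesis by (simp add: d_def)
  next
    case False
    define x where "x = - (a / b)"
    have x: "s x = x" by (simp add: x_def s_hom ab)
    have r: "r - p = x * d"
      using ab(3) False by (simp add: x_def d_def field_simps eq_neg_iff_add_eq_0)
    \<comment> \<open>The left side scales by \<open>x^2\<close> and the right side by
      \<open>x\<close>, so \<open>x\<close> is 0 or 1 and \<open>r\<close> would be \<open>p\<close>
      or \<open>q\<close>.\<close>
    have "x * d * s (s (x * d)) = x * (d * s (s d))"
      using chord_relation[of p d 0 0 x 0 0] assms x
      by (simp add: s_0 d_def flip: r[unfolded d_def])
    then have "x * (x - 1) * (d * s (s d)) = 0"
      by (simp add: s_mult x algebra_simps)
    with d r show ?thesis by auto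
  qed
qed

text \<open>The chord relation and its image under \<open>s ^ 3\<close> say that one vector annihilates two
  consecutive Frobenius translates, so it vanishes by \<open>moore2\<close>.\<close>

lemma pentagon_plane:
  assumes mem: "p \<in> pentagon" "p + d \<in> pentagon" "p + e \<in> pentagon"
      "p + (x * d + y * e) \<in> pentagon"
    and x: "s x = x" and y: "s y = y" and ind: "indep2 d e"
  shows "x = 0 \<or> y = 0"
proof -
  have s5: "s (s (s (s (s d)))) = d" "s (s (s (s (s e)))) = e"
    using s5_diff[OF mem(1,2)] s5_diff[OF mem(1,3)] by simp_all
  define w where "w = x * d + y * e"
  have rel: "w * s (s w) = x * (d * s (s d)) + y * (e * s (s e))"
    using chord_relation[of p d e 0 x y 0] mem x y by (simp add: s_0 w_def)
  have "(x * (w - d)) * s (s d) + (y * (w - e)) * s (s e) = 0"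
    using rel by (simp add: w_def s_add s_mult x y algebra_simps)
  moreover have "(x * (w - d)) * s (s (s d)) + (y * (w - e)) * s (s (s e)) = 0"
    using arg_cong[OF rel, of "\<lambda>t. s (s (s t))"]
    by (simp add: w_def s_add s_mult x y s5 algebra_simps)
  ultimately have "x * (w - d) = 0"
    using moore2[OF indep2_s[OF indep2_s[OF ind]]] by blast
  moreover have "w - d = (x - 1) * d + y * e" by (simp add: w_def algebra_simps)
  ultimately have "x = 0 \<or> (x - 1) * d + y * e = 0" by simp
  then show ?thesis
    using ind[unfolded indep2_def, rule_format, of "x - 1" y] x y by (auto simp: s_hom)
qed

text \<open>A relation with a zero coefficient involves at most two chords and falls to
  \<open>pentagon_indep2\<close>; otherwise it can be solved for \<open>t - p\<close>, and
  \<open>pentagon_plane\<close> forces a zero coefficient after all.\<close>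

lemma pentagon_indep3:
  assumes mem: "p \<in> pentagon" "q \<in> pentagon" "r \<in> pentagon" "t \<in> pentagon"
    and dist: "distinct [p, q, r, t]"
  shows "indep3 (q - p) (r - p) (t - p)"
  unfolding indep3_def
proof (intro allI impI)
  fix a b c assume abc: "s a = a" "s b = b" "s c = c"
    and 0: "a * (q - p) + b * (r - p) + c * (t - p) = 0"
  have ind: "indep2 (q - p) (r - p)" "indep2 (q - p) (t - p)" "indep2 (r - p) (t - p)"
    using pentagon_indep2 mem dist by auto
  show "a = 0 \<and> b = 0 \<and> c = 0"
  proof (cases "a = 0 \<or> b = 0 \<or> c = 0")
    case True
    then consider "a = 0" | "b = 0" | "c = 0" by blast
    then show ?thesis
    proof cases
      case 1
      then show ?thesis using ind(3)[unfolded indep2_def, rule_format, of b c] abc 0 by simp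
    next
      case 2
      then show ?thesis using ind(2)[unfolded indep2_def, rule_format, of a c] abc 0 by simp
    next
      case 3
      then show ?thesis using ind(1)[unfolded indep2_def, rule_format, of a b] abc 0 by simp
    qed
  next
    case False
    define x y where "x = - (a / c)" and "y = - (b / c)"
    have xy: "s x = x" "s y = y" "x \<noteq> 0" "y \<noteq> 0"
      using False by (simp_all add: x_def y_def s_hom abc)
    have "c * (t - p) = - a * (q - p) - b * (r - p)"
      using 0 by (simp add: algebra_simps)
    moreover have "c * x = - a" "c * y = - b" using False by (simp_all add: x_def y_def)
    ultimately have "c * (t - p) = c * (x * (q - p) + y * (r - p))"
      by (simp add: distrib_left flip: mult.assoc)
    then have "t - p = x * (q - p) + y * (r - p)" using False by simp
    then have "p + (x * (q - p) + y * (r - p)) = t" by (simp add: algebra_simps)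
    then have "x = 0 \<or> y = 0"
      using pentagon_plane[of p "q - p" "r - p" x y] mem ind(1) xy by simp
    with xy show ?thesis by simp
  qed
qed

text \<open>Let \<open>v i\<close> be the translates of \<open>(d, e, f)\<close>, indices mod 5. The
  hypotheses say that \<open>B\<close> kills all pairs \<open>v i, v (i+2)\<close> and the pair
  \<open>v 0, v 1\<close>. So \<open>v 0\<close> is orthogonal to \<open>v 1, v 2, v 3\<close>,
  hence in the radical by \<open>moore3\<close>; then \<open>v 1\<close> is orthogonal to
  \<open>v 3, v 4, v 0\<close>, and \<open>v 2\<close> to \<open>v 4, v 0, v 1\<close>. Three
  independent vectors in the radical give \<open>B = 0\<close>. The coefficients need not be fixed
  by \<open>s\<close>, so each \<open>v i\<close> is treated separately.\<close>

lemma symmetric_form_eq_0: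
  fixes a b c h j k d e f :: 'k
  defines "B \<equiv> \<lambda>u v w u' v' w'. a * u * u' + b * v * v' + c * w * w'
      + h * (u * v' + v * u') + j * (u * w' + w * u') + k * (v * w' + w * v')"
  defines "d1 \<equiv> s d" and "e1 \<equiv> s e" and "f1 \<equiv> s f"
  defines "d2 \<equiv> s d1" and "e2 \<equiv> s e1" and "f2 \<equiv> s f1"
  defines "d3 \<equiv> s d2" and "e3 \<equiv> s e2" and "f3 \<equiv> s f2"
  defines "d4 \<equiv> s d3" and "e4 \<equiv> s e3" and "f4 \<equiv> s f3"
  assumes s5: "s d4 = d" "s e4 = e" "s f4 = f" and ind: "indep3 d e f"
    and B: "B d e f d2 e2 f2 = 0" "B d1 e1 f1 d3 e3 f3 = 0" "B d2 e2 f2 d4 e4 f4 = 0"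
      "B d3 e3 f3 d e f = 0" "B d4 e4 f4 d1 e1 f1 = 0" "B d e f d1 e1 f1 = 0"
  shows "a = 0" "b = 0" "c = 0" "h = 0" "j = 0" "k = 0"
proof -
  have ind1: "indep3 d1 e1 f1" unfolding d1_def e1_def f1_def by (rule indep3_s[OF ind])
  have ind2: "indep3 d2 e2 f2" unfolding d2_def e2_def f2_def by (rule indep3_s[OF ind1])
  have ind3: "indep3 d3 e3 f3" unfolding d3_def e3_def f3_def by (rule indep3_s[OF ind2])
  have ind4: "indep3 d4 e4 f4" unfolding d4_def e4_def f4_def by (rule indep3_s[OF ind3])
  \<comment> \<open>The rows of the matrix of \<open>B\<close>; by symmetry they can be applied to
    either argument.\<close>
  define P Q R where "P = (\<lambda>u v w. a * u + h * v + j * w)"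
    and "Q = (\<lambda>u v w. h * u + b * v + k * w)"
    and "R = (\<lambda>u v w. j * u + k * v + c * w)"
  have B1: "B u v w u' v' w' = P u v w * u' + Q u v w * v' + R u v w * w'" for u v w u' v' w'
    by (simp add: B_def P_def Q_def R_def algebra_simps)
  have B2: "B u v w u' v' w' = P u' v' w' * u + Q u' v' w' * v + R u' v' w' * w" for u v w u' v' w'
    by (simp add: B_def P_def Q_def R_def algebra_simps)
  have v0: "P d e f = 0 \<and> Q d e f = 0 \<and> R d e f = 0"
  proof (rule moore3[OF ind1])
    show "P d e f * d1 + Q d e f * e1 + R d e f * f1 = 0" using B(6) by (simp add: B1)
    show "P d e f * s d1 + Q d e f * s e1 + R d e f * s f1 = 0"
      using B(1) by (simp add: B1 d2_def e2_def f2_def)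
    show "P d e f * s (s d1) + Q d e f * s (s e1) + R d e f * s (s f1) = 0"
      using B(4) unfolding B2 by (simp add: d3_def e3_def f3_def d2_def e2_def f2_def)
  qed
  have v1: "P d1 e1 f1 = 0 \<and> Q d1 e1 f1 = 0 \<and> R d1 e1 f1 = 0"
  proof (rule moore3[OF ind3])
    show "P d1 e1 f1 * d3 + Q d1 e1 f1 * e3 + R d1 e1 f1 * f3 = 0" using B(2) by (simp add: B1)
    show "P d1 e1 f1 * s d3 + Q d1 e1 f1 * s e3 + R d1 e1 f1 * s f3 = 0"
      using B(5) unfolding B2 by (simp add: d4_def e4_def f4_def)
    show "P d1 e1 f1 * s (s d3) + Q d1 e1 f1 * s (s e3) + R d1 e1 f1 * s (s f3) = 0"
      using B(6) unfolding B2 by (simp add: s5 flip: d4_def e4_def f4_def)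
  qed
  have v2: "P d2 e2 f2 = 0 \<and> Q d2 e2 f2 = 0 \<and> R d2 e2 f2 = 0"
  proof (rule moore3[OF ind4])
    show "P d2 e2 f2 * d4 + Q d2 e2 f2 * e4 + R d2 e2 f2 * f4 = 0" using B(3) by (simp add: B1)
    show "P d2 e2 f2 * s d4 + Q d2 e2 f2 * s e4 + R d2 e2 f2 * s f4 = 0"
      using B(1) unfolding B2 by (simp add: s5)
    have "P d2 e2 f2 * d1 + Q d2 e2 f2 * e1 + R d2 e2 f2 * f1
        = P d1 e1 f1 * d2 + Q d1 e1 f1 * e2 + R d1 e1 f1 * f2"
      using B1[of d1 e1 f1 d2 e2 f2] B2[of d1 e1 f1 d2 e2 f2] by simp
    then have "P d2 e2 f2 * d1 + Q d2 e2 f2 * e1 + R d2 e2 f2 * f1 = 0" using v1 by simp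
    then show "P d2 e2 f2 * s (s d4) + Q d2 e2 f2 * s (s e4) + R d2 e2 f2 * s (s f4) = 0"
      by (simp add: s5 flip: d1_def e1_def f1_def)
  qed
  note zero = moore3[OF ind, folded d1_def e1_def f1_def, folded d2_def e2_def f2_def]
  have "a = 0 \<and> h = 0 \<and> j = 0"
    by (rule zero) (use v0 v1 v2 in \<open>simp_all only: P_def\<close>)
  moreover have "h = 0 \<and> b = 0 \<and> k = 0"
    by (rule zero) (use v0 v1 v2 in \<open>simp_all only: Q_def\<close>)
  moreover have "j = 0 \<and> k = 0 \<and> c = 0"
    by (rule zero) (use v0 v1 v2 in \<open>simp_all only: R_def\<close>)
  ultimately show "a = 0" "b = 0" "c = 0" "h = 0" "j = 0" "k = 0" by blast+
qed


text \<open>Two further points in the solid of four points give two symmetric forms; some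
  combination of them also vanishes on consecutive translates, hence is 0 by
  \<open>symmetric_form_eq_0\<close>.\<close>

lemma pentagon_solid:
  assumes mem: "p \<in> pentagon" "p + d \<in> pentagon" "p + e \<in> pentagon" "p + f \<in> pentagon"
      "p + (x * d + y * e + z * f) \<in> pentagon" "p + (x' * d + y' * e + z' * f) \<in> pentagon"
    and fix_s: "s x = x" "s y = y" "s z = z" "s x' = x'" "s y' = y'" "s z' = z'"
    and nz: "x \<noteq> 0" "y \<noteq> 0" "z \<noteq> 0" "x' \<noteq> 0" "y' \<noteq> 0" "z' \<noteq> 0"
    and ind: "indep3 d e f"
  shows "x = x' \<and> y = y' \<and> z = z'"
proof -
  define L where "L = (\<lambda>x y z u v w u' v' w'. (x * (x - 1)) * u * u' + (y * (y - 1)) * v * v'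
      + (z * (z - 1)) * w * w' + (x * y) * (u * v' + v * u') + (x * z) * (u * w' + w * u')
      + (y * z) * (v * w' + w * v') :: 'k)"
  have L: "L x y z u v w u' v' w' = (x * u + y * v + z * w) * (x * u' + y * v' + z * w')
      - (x * (u * u') + y * (v * v') + z * (w * w'))" for x y z u v w u' v' w'
    by (simp add: L_def algebra_simps)
  have s5: "s (s (s (s (s d)))) = d" "s (s (s (s (s e)))) = e" "s (s (s (s (s f)))) = f"
    using s5_diff[OF mem(1,2)] s5_diff[OF mem(1,3)] s5_diff[OF mem(1,4)] by simp_all
  have sL: "s (L x y z u v w u' v' w') = L x y z (s u) (s v) (s w) (s u') (s v') (s w')"
    if "s x = x" "s y = y" "s z = z" for x y z u v w u' v' w'
    by (simp add: L s_hom that)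
  have L0: "L x y z d e f (s (s d)) (s (s e)) (s (s f)) = 0"
    using chord_relation[OF mem(1-5) fix_s(1-3)] by (simp add: L s_hom fix_s)
  have L0': "L x' y' z' d e f (s (s d)) (s (s e)) (s (s f)) = 0"
    using chord_relation[OF mem(1-4,6) fix_s(4-6)] by (simp add: L s_hom fix_s)
  note L1 = arg_cong[OF L0, of s, unfolded sL[OF fix_s(1-3)] s_0]
  note L2 = arg_cong[OF L1, of s, unfolded sL[OF fix_s(1-3)] s_0]
  note L3 = arg_cong[OF L2, of s, unfolded sL[OF fix_s(1-3)] s_0 s5]
  note L4 = arg_cong[OF L3, of s, unfolded sL[OF fix_s(1-3)] s_0 s5]
  note L1' = arg_cong[OF L0', of s, unfolded sL[OF fix_s(4-6)] s_0]
  note L2' = arg_cong[OF L1', of s, unfolded sL[OF fix_s(4-6)] s_0]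
  note L3' = arg_cong[OF L2', of s, unfolded sL[OF fix_s(4-6)] s_0 s5]
  note L4' = arg_cong[OF L3', of s, unfolded sL[OF fix_s(4-6)] s_0 s5]
  let ?t = "L x y z d e f (s d) (s e) (s f)" and ?t' = "L x' y' z' d e f (s d) (s e) (s f)"
  \<comment> \<open>The two forms are scaled so that their values on the consecutive pair cancel.
    The scalars need not be fixed by \<open>s\<close>, which is harmless because \<open>s\<close> is
    applied to each form before combining.\<close>
  obtain m n where mn: "m * ?t - n * ?t' = 0" "m \<noteq> 0 \<or> n \<noteq> 0"
  proof (cases "?t = 0")
    case True
    then show ?thesis using that[of 1 0] by simp
  next
    case False
    then show ?thesis using that[of ?t' ?t] by simp
  qed
  have comb: "(m * (x * (x - 1)) - n * (x' * (x' - 1))) * u * u'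
      + (m * (y * (y - 1)) - n * (y' * (y' - 1))) * v * v'
      + (m * (z * (z - 1)) - n * (z' * (z' - 1))) * w * w'
      + (m * (x * y) - n * (x' * y')) * (u * v' + v * u')
      + (m * (x * z) - n * (x' * z')) * (u * w' + w * u')
      + (m * (y * z) - n * (y' * z')) * (v * w' + w * v')
      = m * L x y z u v w u' v' w' - n * L x' y' z' u v w u' v' w'" for u v w u' v' w'
    unfolding L_def by (simp add: algebra_simps)
  note * = symmetric_form_eq_0[of d e f, OF s5 ind,
      of "m * (x * (x - 1)) - n * (x' * (x' - 1))" "m * (y * (y - 1)) - n * (y' * (y' - 1))"
      "m * (z * (z - 1)) - n * (z' * (z' - 1))" "m * (x * y) - n * (x' * y')"
      "m * (x * z) - n * (x' * z')" "m * (y * z) - n * (y' * z')", unfolded comb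
      L0 L1 L2 L3 L4 L0' L1' L2' L3' L4' mn(1), simplified]
  have xy: "m * (x * y) = n * (x' * y')" and xz: "m * (x * z) = n * (x' * z')"
    and yz: "m * (y * z) = n * (y' * z')"
    and xx: "m * (x * (x - 1)) = n * (x' * (x' - 1))"
    and yy: "m * (y * (y - 1)) = n * (y' * (y' - 1))"
    and zz: "m * (z * (z - 1)) = n * (z' * (z' - 1))"
    using * by simp_all
  have m: "m \<noteq> 0" "n \<noteq> 0" using mn(2) xy nz by auto
  \<comment> \<open>Off-diagonal entries give \<open>a * b' = a' * b\<close>. The diagonal entry is
    not homogeneous and gives \<open>(a - 1) * b' = (a' - 1) * b\<close>; the difference is the
    claim.\<close>
  have eq: "b = b'"
    if ab: "m * (a * b) = n * (a' * b')" and ac: "m * (a * c) = n * (a' * c')"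
      and bc: "m * (b * c) = n * (b' * c')" and aa: "m * (a * (a - 1)) = n * (a' * (a' - 1))"
      and nz: "a \<noteq> 0" "b \<noteq> 0" "c \<noteq> 0" "a' \<noteq> 0" "b' \<noteq> 0" "c' \<noteq> 0" for a b c a' b' c' :: 'k
  proof -
    have "(m * (a * c)) * (n * (b' * c')) = (n * (a' * c')) * (m * (b * c))"
      using ac bc by simp
    then have "(m * n * c * c') * (a * b') = (m * n * c * c') * (a' * b)"
      by (simp add: algebra_simps)
    then have 1: "a * b' = a' * b" using m nz by simp
    have "(m * (a * (a - 1))) * (n * (a' * b')) = (n * (a' * (a' - 1))) * (m * (a * b))"
      using ab aa by simp
    then have "(m * n * a * a') * ((a - 1) * b') = (m * n * a * a') * ((a' - 1) * b)"
      by (simp only: mult_ac)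
    then have "(a - 1) * b' = (a' - 1) * b" using m nz by simp
    then show ?thesis using 1 by (simp add: algebra_simps)
  qed
  have "y = y'" by (rule eq[OF xy xz yz xx nz])
  moreover have "x = x'"
    by (rule eq[OF _ yz xz yy nz(2,1,3,5,4,6)]) (use xy in \<open>simp add: mult_ac\<close>)
  moreover have "z = z'"
    by (rule eq[OF xz xy _ xx nz(1,3,2,4,6,5)]) (use yz in \<open>simp add: mult_ac\<close>)
  ultimately show ?thesis by simp
qed

end

subsection \<open>Frobenius on the algebraic closure of a finite field\<close>

lemma finite_field_power_card:
  fixes x :: "'a::{finite,field}"
  shows "x ^ CARD('a) = x"
proof (cases "x = 0")
  case False
  have "(\<Prod>y\<in>UNIV - {0}. y) = (\<Prod>y\<in>UNIV - {0}. x * y)"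
    by (rule prod.reindex_bij_witness[of _ "\<lambda>y. x * y" "\<lambda>y. y / x"]) (use False in auto)
  then have "x ^ (CARD('a) - 1) = 1"
    by (simp add: prod.distrib card_Diff_singleton)
  moreover have "CARD('a) = Suc (CARD('a) - 1)" by simp
  ultimately show ?thesis by (metis mult.right_neutral power_Suc)
qed simp

lemma of_nat_CARD_eq_0: "of_nat CARD('a) = (0 :: 'a::{finite,field})"
proof -
  have "(\<Sum>x\<in>UNIV. x) = (\<Sum>x\<in>UNIV. x + 1 :: 'a)"
    by (rule sum.reindex_bij_witness[of _ "\<lambda>y. y + 1" "\<lambda>y. y - 1"]) auto
  then show ?thesis by (simp add: sum.distrib)
qed

text \<open>These are the coefficients of \<open>(x + 1)^q - x^q - 1\<close>, which vanishes at all
  \<open>q\<close> field elements and has degree below \<open>q\<close>.\<close>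

lemma of_nat_CARD_choose_eq_0:
  assumes "0 < k" "k < CARD('a)"
  shows "of_nat (CARD('a) choose k) = (0 :: 'a::{finite,field})"
proof -
  let ?q = "CARD('a)"
  define P :: "'a poly" where "P = (\<Sum>k\<in>{0<..<?q}. Polynomial.monom (of_nat (?q choose k)) k)"
  have "poly P x = 0" for x
  proof -
    have "x + 1 = (x + 1) ^ ?q" by (simp add: finite_field_power_card)
    also have "\<dots> = (\<Sum>k\<le>?q. of_nat (?q choose k) * x ^ k)"
      by (simp add: binomial_ring)
    also have "{..?q} = insert 0 (insert ?q {0<..<?q})" by auto
    finally show ?thesis
      by (simp add: P_def poly_sum poly_monom finite_field_power_card)
  qed
  then have "card {x. poly P x = 0} = ?q" by simp
  moreover have "Polynomial.degree P < ?q"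
    unfolding P_def
    by (intro degree_sum_less) (auto intro: le_less_trans[OF degree_monom_le])
  ultimately have "P = 0" using card_poly_roots_bound[of P] by linarith
  then have "Polynomial.coeff P k = 0" by simp
  then show ?thesis
    using assms by (simp add: P_def coeff_sum sum.delta')
qed

definition frob :: "'a::{finite,field} alg_closure \<Rightarrow> 'a alg_closure" where
  "frob x = x ^ CARD('a)"

lemma frob_add: "frob (x + y) = frob x + frob (y :: 'a::{finite,field} alg_closure)"
proof -
  let ?q = "CARD('a)"
  have "(x + y) ^ ?q = (\<Sum>k\<le>?q. of_nat (?q choose k) * x ^ k * y ^ (?q - k))"
    by (rule binomial_ring)
  also have "\<dots> = (\<Sum>k\<in>{0, ?q}. of_nat (?q choose k) * x ^ k * y ^ (?q - k))"
  proof (rule sum.mono_neutral_right)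
    show "\<forall>k\<in>{..?q} - {0, ?q}. of_nat (?q choose k) * x ^ k * y ^ (?q - k) = 0"
    proof
      fix k assume "k \<in> {..?q} - {0, ?q}"
      then have "of_nat (?q choose k) = (0 :: 'a)" by (intro of_nat_CARD_choose_eq_0) auto
      then have "to_ac (of_nat (?q choose k) :: 'a) = 0" by simp
      then have "of_nat (?q choose k) = (0 :: 'a alg_closure)" by simp
      then show "of_nat (?q choose k) * x ^ k * y ^ (?q - k) = 0" by simp
    qed
  qed auto
  also have "\<dots> = x ^ ?q + y ^ ?q" by simp
  finally show ?thesis by (simp add: frob_def)
qed

interpretation frob: field_endomorphism frob
  by standard (rule frob_add, simp_all add: frob_def power_mult_distrib)

section \<open>Counting fixed points and pentagon points by separable polynomials\<close>

lemma frob_power: "(frob ^^ n) x = x ^ (CARD('a) ^ n)"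
  for x :: "'a::{finite,field} alg_closure"
  by (induction n) (simp_all add: frob_def mult.commute flip: power_mult)

text \<open>A repeated linear factor would also divide the derivative, so the multiset of roots in
  the full factorization is a set.\<close>

lemma card_roots_separable:
  fixes p :: "'a::alg_closed_field poly"
  assumes "\<And>x. poly p x = 0 \<Longrightarrow> poly (pderiv p) x \<noteq> 0" and p: "p \<noteq> 0"
  shows "card {x. poly p x = 0} = Polynomial.degree p"
proof -
  obtain A where A: "size A = Polynomial.degree p"
    "p = Polynomial.smult (Polynomial.lead_coeff p) (\<Prod>x\<in>#A. [:-x, 1:])"
    using alg_closed_imp_factorization[OF p] by blast
  have count: "count A x \<le> 1" for x
  proof (rule ccontr)
    assume "\<not> count A x \<le> 1"
    then have "{#x, x#} \<subseteq># A" by (auto simp: subseteq_mset_def)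
    then obtain B where B: "A = {#x, x#} + B" by (metis subset_mset.le_iff_add)
    define r where "r = Polynomial.smult (Polynomial.lead_coeff p) (\<Prod>x\<in>#B. [:-x, 1:])"
    have pr: "p = [:-x, 1:] * ([:-x, 1:] * r)"
      using A(2) unfolding r_def B by (simp add: mult_ac)
    have "poly p x = 0" "poly (pderiv p) x = 0"
      unfolding pr pderiv_mult by (simp_all only: poly_mult poly_add) simp_all
    then show False using assms(1) by blast
  qed
  have "{x. poly p x = 0} = set_mset A"
  proof -
    have "poly p x = Polynomial.lead_coeff p * (\<Prod>a\<in>#A. x - a)" for x
      using arg_cong[OF A(2), of "\<lambda>p. poly p x"] by (simp add: poly_prod_mset)
    then show ?thesis using p by (auto simp: prod_mset_zero_iff)
  qed
  moreover have "size A = card (set_mset A)"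
  proof -
    have "count A x = 1" if "x \<in># A" for x
      using that count[of x] by (meson antisym count_greater_eq_one_iff)
    then show ?thesis by (simp add: size_multiset_overloaded_eq)
  qed
  ultimately show ?thesis using A(1) by simp
qed

lemma of_nat_CARD_alg_closure: "of_nat CARD('a) = (0 :: 'a::{finite,field} alg_closure)"
  using of_nat_CARD_eq_0[where ?'a = 'a] by (metis to_ac_0 to_ac_of_nat)

lemma one_less_CARD: "1 < CARD('a::{finite,field})"
proof -
  have "card {0, 1 :: 'a} \<le> CARD('a)" by (rule card_mono) auto
  then show ?thesis by simp
qed

lemma card_frob_power_fixed:
  assumes n: "n > 0"
  shows "card {x :: 'a::{finite,field} alg_closure. (frob ^^ n) x = x} = CARD('a) ^ n"
proof -
  let ?Q = "CARD('a) ^ n"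
  have Q: "1 < ?Q" using one_less_CARD[where ?'a = 'a] n by (rule one_less_power)
  define p :: "'a alg_closure poly" where "p = Polynomial.monom 1 ?Q + [:0, -1:]"
  have deg: "Polynomial.degree p = ?Q"
    unfolding p_def using Q by (subst degree_add_eq_left) (auto simp: degree_monom_eq)
  have "of_nat ?Q = (0 :: 'a alg_closure)"
    using n by (simp add: of_nat_CARD_alg_closure)
  then have "pderiv p = [:-1:]"
    by (simp add: p_def pderiv_add pderiv_monom pderiv_pCons)
  then have "card {x. poly p x = 0} = ?Q"
    using card_roots_separable[of p] deg Q by force
  then show ?thesis
    by (simp add: p_def poly_monom frob_power)
qed

text \<open>The base field consists of fixed points, and both sets have \<open>q\<close> elements.
  This identifies scalars fixed by \<open>frob\<close> with scalars of the base field.\<close>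

lemma frob_fixed_iff: "frob x = x \<longleftrightarrow> x \<in> range to_ac"
  for x :: "'a::{finite,field} alg_closure"
proof -
  have "range to_ac = {x :: 'a alg_closure. frob x = x}"
  proof (rule card_subset_eq)
    have *: "card {x :: 'a alg_closure. frob x = x} = CARD('a)"
      using card_frob_power_fixed[of 1, where ?'a = 'a] by simp
    then show "finite {x :: 'a alg_closure. frob x = x}"
      by (metis card.infinite zero_less_card_finite less_irrefl)
    show "range to_ac \<subseteq> {x :: 'a alg_closure. frob x = x}"
      by (auto simp: frob_def finite_field_power_card simp flip: to_ac_power)
    show "card (range (to_ac :: 'a \<Rightarrow> _)) = card {x :: 'a alg_closure. frob x = x}"
      unfolding * by (rule card_image[OF inj_to_ac])
  qed
  then show ?thesis by blast
qed

lemma frob_to_ac [simp]: "frob (to_ac c) = to_ac c"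
  by (simp add: frob_fixed_iff)

text \<open>In characteristic dividing \<open>q\<close> the polynomial
  \<open>y^(q^2+1) - y^q - 1\<close> has derivative \<open>y^(q^2)\<close>, whose only root 0 is not
  a root of the polynomial.\<close>

lemma card_frob_pentagon:
  "card (frob.pentagon :: 'a::{finite,field} alg_closure set) = CARD('a) ^ 2 + 1"
proof -
  let ?q = "CARD('a)"
  have q: "1 < ?q" by (rule one_less_CARD)
  then have q2: "?q < ?q ^ 2 + 1" by (simp add: power2_eq_square less_Suc_eq)
  define p :: "'a alg_closure poly" where
    "p = Polynomial.monom 1 (?q ^ 2 + 1) + (- Polynomial.monom 1 ?q - 1)"
  have "Polynomial.degree (- Polynomial.monom 1 ?q - 1 :: 'a alg_closure poly) \<le> ?q"
    by (intro degree_diff_le) (simp_all add: degree_monom_eq)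
  then have deg: "Polynomial.degree p = ?q ^ 2 + 1"
    unfolding p_def using q2 by (subst degree_add_eq_left) (auto simp: degree_monom_eq)
  have deriv: "pderiv p = Polynomial.monom 1 (?q ^ 2)"
    by (simp add: p_def pderiv_add pderiv_diff pderiv_minus pderiv_monom of_nat_CARD_alg_closure)
  have "poly p 0 \<noteq> 0" by (simp add: p_def poly_monom power_0_left)
  then have "card {x. poly p x = 0} = Polynomial.degree p"
    by (intro card_roots_separable) (auto simp: deriv poly_monom)
  then have "card {x. poly p x = 0} = ?q ^ 2 + 1" by (simp only: deg)
  also have "{x. poly p x = 0} = frob.pentagon"
    by (auto simp: p_def poly_monom frob.pentagon_def frob_def power2_eq_square algebra_simps
        simp flip: power_mult)
  finally show ?thesis .
qed

subsection \<open>The field of order \<open>q\<^sup>5\<close> as a vector space\<close>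

context vector_space
begin

lemma card_span:
  assumes B: "finite B" "independent B"
  shows "card (span B) = CARD('a) ^ card B"
proof -
  let ?f = "\<lambda>u. \<Sum>b\<in>B. scale (u b) b"
  have inj: "inj_on ?f (B \<rightarrow>\<^sub>E UNIV)"
  proof
    fix u v assume uv: "u \<in> B \<rightarrow>\<^sub>E UNIV" "v \<in> B \<rightarrow>\<^sub>E UNIV" and "?f u = ?f v"
    then have 0: "(\<Sum>b\<in>B. scale (u b - v b) b) = 0"
      by (simp add: scale_left_diff_distrib sum_subtractf)
    have "u b - v b = 0" if "b \<in> B" for b
      by (rule independentD[OF B(2,1) subset_refl 0 that])
    then show "u = v" using uv by (intro PiE_ext) auto
  qed
  have img: "?f ` (B \<rightarrow>\<^sub>E UNIV) = span B"
  proof -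
    have "?f u \<in> ?f ` (B \<rightarrow>\<^sub>E UNIV)" for u
      by (rule image_eqI[of _ _ "restrict u B"]) (auto intro!: sum.cong)
    then show ?thesis unfolding span_finite[OF B(1)] by blast
  qed
  have "card (span B) = card (B \<rightarrow>\<^sub>E (UNIV :: 'a set))"
    using card_image[OF inj] unfolding img .
  then show ?thesis using B(1) by (simp add: card_PiE)
qed

end

interpretation ac: vector_space "\<lambda>c x. to_ac c * x"
  by standard (simp_all add: algebra_simps)

definition quintic :: "'a::{finite,field} alg_closure set" where
  "quintic = {x. frob (frob (frob (frob (frob x)))) = x}"

text \<open>On \<open>quintic\<close> this is the field trace to the base field.\<close>

definition tr :: "'a::{finite,field} alg_closure \<Rightarrow> 'a alg_closure" where
  "tr x = x + frob x + frob (frob x) + frob (frob (frob x)) + frob (frob (frob (frob x)))"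

lemma pentagon_subset_quintic: "frob.pentagon \<subseteq> quintic"
  by (auto simp: quintic_def frob.pentagon_orbit(3))

lemma card_quintic: "card (quintic :: 'a::{finite,field} alg_closure set) = CARD('a) ^ 5"
  using card_frob_power_fixed[of 5, where ?'a = 'a] by (simp add: quintic_def eval_nat_numeral)

lemma finite_quintic: "finite (quintic :: 'a::{finite,field} alg_closure set)"
  using card_quintic[where ?'a = 'a] by (metis card.infinite zero_less_card_finite zero_less_power less_irrefl)

lemma quintic_closed:
  "x \<in> quintic \<Longrightarrow> y \<in> quintic \<Longrightarrow> x + y \<in> quintic"
  "x \<in> quintic \<Longrightarrow> y \<in> quintic \<Longrightarrow> x - y \<in> quintic"
  "x \<in> quintic \<Longrightarrow> y \<in> quintic \<Longrightarrow> x * y \<in> quintic"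
  "x \<in> quintic \<Longrightarrow> y \<in> quintic \<Longrightarrow> x / y \<in> quintic"
  "to_ac c \<in> quintic" "0 \<in> quintic"
  by (simp_all add: quintic_def frob.s_hom)

lemma subspace_quintic: "ac.subspace quintic"
  by (simp add: ac.subspace_def quintic_closed)

lemma tr_add: "tr (x + y) = tr x + tr y"
  by (simp add: tr_def frob.s_add)

lemma tr_scale: "tr (to_ac c * x) = to_ac c * tr x"
  by (simp add: tr_def frob.s_mult distrib_left)

lemma tr_0 [simp]: "tr 0 = 0"
  by (simp add: tr_def frob.s_0)

lemma tr_sum: "tr (\<Sum>i\<in>A. f i) = (\<Sum>i\<in>A. tr (f i))"
  by (induction A rule: infinite_finite_induct) (simp_all add: tr_add)

lemma tr_in_range: "x \<in> quintic \<Longrightarrow> tr x \<in> range to_ac"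
  unfolding frob_fixed_iff[symmetric] by (simp add: tr_def quintic_def frob.s_add)

text \<open>The trace is a non-zero polynomial of degree at most \<open>q^4\<close> and cannot
  vanish at \<open>q^5\<close> points.\<close>

lemma tr_nontrivial: "\<exists>x \<in> quintic. tr x \<noteq> (0 :: 'a::{finite,field} alg_closure)"
proof (rule ccontr)
  assume tr0: "\<not> ?thesis"
  let ?q = "CARD('a)"
  note q = one_less_CARD[where ?'a = 'a]
  define p :: "'a alg_closure poly" where "p = (\<Sum>i<5. Polynomial.monom 1 (?q ^ i))"
  have poly: "poly p x = tr x" for x
  proof -
    have "poly p x = (\<Sum>i<5. (frob ^^ i) x)" by (simp add: p_def poly_sum poly_monom frob_power)
    also have "\<dots> = tr x" by (simp add: tr_def eval_nat_numeral)
    finally show ?thesis .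
  qed
  have "Polynomial.coeff p 1 = (\<Sum>i<5::nat. if i = 0 then 1 else 0)"
    unfolding p_def coeff_sum using q by (intro sum.cong) auto
  then have "Polynomial.coeff p 1 = 1" by simp
  then have p: "p \<noteq> 0" by auto
  have "Polynomial.degree p \<le> ?q ^ 4"
    unfolding p_def
    by (intro degree_sum_le) (use q in \<open>auto simp: degree_monom_eq intro!: power_increasing\<close>)
  moreover have "card (quintic :: 'a alg_closure set) \<le> card {x. poly p x = 0}"
    using tr0 poly_roots_finite[OF p] by (intro card_mono) (auto simp: poly)
  moreover have "?q ^ 4 < ?q ^ 5" using q by simp
  ultimately show False using card_poly_roots_bound[OF p] by (simp add: card_quintic)
qed

lemma tr_nondegenerate:
  fixes w :: "'a::{finite,field} alg_closure"
  assumes w: "w \<in> quintic" and 0: "\<And>b. b \<in> quintic \<Longrightarrow> tr (b * w) = 0"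
  shows "w = 0"
proof (rule ccontr)
  assume "w \<noteq> 0"
  obtain x :: "'a alg_closure" where x: "x \<in> quintic" "tr x \<noteq> 0" using tr_nontrivial by blast
  have "tr (x / w * w) = 0" by (intro 0 quintic_closed x w)
  with x \<open>w \<noteq> 0\<close> show False by simp
qed

text \<open>Prepares the coordinates \<open>tr (b k * w)\<close> on \<open>quintic\<close>: the
  second property makes them injective, and independence of the \<open>b k\<close> makes non-zero
  linear forms correspond to non-zero field elements.\<close>

lemma quintic_basis:
  fixes I :: "'i set"
  assumes I: "card I = 5"
  obtains b :: "'i \<Rightarrow> 'a::{finite,field} alg_closure"
  where "\<And>k. k \<in> I \<Longrightarrow> b k \<in> quintic"
    and "\<And>w. w \<in> quintic \<Longrightarrow> (\<And>k. k \<in> I \<Longrightarrow> tr (b k * w) = 0) \<Longrightarrow> w = 0"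
    and "\<And>h k. (\<Sum>k\<in>I. to_ac (h k) * b k) = 0 \<Longrightarrow> k \<in> I \<Longrightarrow> h k = 0"
proof -
  obtain B :: "'a alg_closure set" where B: "B \<subseteq> quintic" "ac.independent B" "quintic \<subseteq> ac.span B"
    by (rule ac.maximal_independent_subset)
  have fin: "finite B" using B(1) finite_quintic finite_subset by blast
  have span: "ac.span B = quintic"
    by (rule ac.span_subspace[OF B(1,3) subspace_quintic])
  \<comment> \<open>The dimension 5 is read off by comparing cardinalities.\<close>
  have "CARD('a) ^ card B = CARD('a) ^ 5"
    using ac.card_span[OF fin B(2)] by (simp add: span card_quintic)
  then have "card B = 5" using one_less_CARD[where ?'a = 'a] by simp
  moreover have "finite I" using I card.infinite by fastforce
  ultimately obtain b where b: "bij_betw b I B"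
    using fin I by (metis finite_same_card_bij)
  show ?thesis
  proof (rule that[of b])
    show "b k \<in> quintic" if "k \<in> I" for k using b B(1) that by (auto simp: bij_betw_def)
    show "w = 0" if w: "w \<in> quintic" and 0: "\<And>k. k \<in> I \<Longrightarrow> tr (b k * w) = 0" for w
    proof (rule tr_nondegenerate[OF w])
      fix x :: "'a alg_closure" assume "x \<in> quintic"
      then obtain u where u: "x = (\<Sum>y\<in>B. to_ac (u y) * y)"
        using span ac.span_finite[OF fin] by auto
      have "tr (y * w) = 0" if "y \<in> B" for y using 0 b that by (auto simp: bij_betw_def)
      then show "tr (x * w) = 0"
        by (simp add: u sum_distrib_right tr_sum mult.assoc tr_scale)
    qed
    show "h k = 0" if 0: "(\<Sum>k\<in>I. to_ac (h k) * b k) = 0" and k: "k \<in> I" for h k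
    proof -
      let ?u = "\<lambda>y. h (inv_into I b y)"
      have "(\<Sum>y\<in>B. to_ac (?u y) * y) = (\<Sum>k\<in>I. to_ac (?u (b k)) * b k)"
        using sum.reindex_bij_betw[OF b, of "\<lambda>y. to_ac (?u y) * y"] by simp
      also have "\<dots> = (\<Sum>k\<in>I. to_ac (h k) * b k)"
        using b by (intro sum.cong) (auto simp: bij_betw_def inv_into_f_f)
      finally have "?u (b k) = 0"
        using ac.independentD[OF B(2) fin subset_refl, of ?u "b k"] 0 k b
        by (auto simp: bij_betw_def)
      then show "h k = 0" using b k by (simp add: bij_betw_def inv_into_f_f)
    qed
  qed
qed

subsection \<open>Hyperplane sections\<close>

text \<open>Some linear map kills \<open>S\<close> and fixes a vector outside \<open>S\<close>; any
  non-zero row of its matrix is the required form.\<close>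

lemma proper_subspace_linear_form:
  fixes S :: "('a::field ^ 'n) set"
  assumes S: "vec.subspace S" "S \<noteq> UNIV"
  obtains h where "h \<noteq> 0" "\<And>v. v \<in> S \<Longrightarrow> (\<Sum>k\<in>UNIV. h $ k * v $ k) = 0"
proof -
  obtain B where B: "B \<subseteq> S" "vec.independent B" "S \<subseteq> vec.span B"
    by (rule vec.maximal_independent_subset)
  have span: "vec.span B = S" by (rule vec.span_subspace[OF B(1,3) S(1)])
  obtain v where v: "v \<notin> S" using S(2) by blast
  then have "vec.independent (insert v B)" using B(2) span by (intro vec.independent_insertI) auto
  then obtain g where g: "Vector_Spaces.linear (*s) (*s) g"
    "\<forall>x\<in>insert v B. g x = (if x = v then v else 0)"
    using vec.linear_independent_extend[where f = "\<lambda>x. if x = v then v else 0"] by blast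
  have "g x = 0" if "x \<in> S" for x
  proof (rule vec.linear_eq_0_on_span[OF g(1)])
    show "x \<in> vec.span B" using that span by simp
    show "g y = 0" if "y \<in> B" for y using g(2) that B(1) v by auto
  qed
  moreover have "g x $ i = (\<Sum>k\<in>UNIV. matrix g $ i $ k * x $ k)" for x i
    using matrix_works[OF g(1), of x] by (simp add: matrix_vector_mult_def vec_eq_iff)
  ultimately have zero: "(\<Sum>k\<in>UNIV. matrix g $ i $ k * x $ k) = 0" if "x \<in> S" for x i
    using that by (metis zero_index)
  have "v \<noteq> 0" using v S(1) vec.subspace_0 by blast
  moreover have "matrix g *v v = v" using matrix_works[OF g(1)] g(2) by simp
  ultimately have "matrix g \<noteq> 0" by (metis matrix_vector_mult_0)
  then obtain i where "matrix g $ i \<noteq> 0" by (metis vec_eq_iff zero_index)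
  then show ?thesis using that zero by blast
qed

text \<open>Multiplying the equation by \<open>y * frob y\<close> turns the iterates of
  \<open>y\<close> into polynomials in \<open>y\<close> and \<open>frob y\<close>, by the pentagon
  identities. Since \<open>frob y = y^q\<close>, the degree is \<open>2 * q + 1\<close>, with
  leading coefficient \<open>frob \<beta>\<close>.\<close>

lemma hyperplane_section_bound:
  fixes \<beta> :: "'a::{finite,field} alg_closure"
  assumes q: "CARD('a) \<ge> 3" and nz: "\<beta> \<noteq> 0 \<or> c \<noteq> 0"
  shows "card {y \<in> frob.pentagon. c + tr (\<beta> * y) = 0} \<le> 2 * CARD('a) + 1"
proof (cases "\<beta> = 0")
  case True
  with nz show ?thesis by simp
next
  case False
  let ?q = "CARD('a)"
  define b1 b2 b3 b4 where "b1 = frob \<beta>" and "b2 = frob b1" and "b3 = frob b2" and "b4 = frob b3"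
  define P where "P = Polynomial.monom b1 (2 * ?q + 1) + (Polynomial.monom \<beta> (?q + 2)
    + Polynomial.monom c (?q + 1) + Polynomial.monom b2 (2 * ?q) + Polynomial.monom b2 ?q
    + Polynomial.monom b3 0 + Polynomial.monom b3 1 + Polynomial.monom b3 ?q
    + Polynomial.monom b4 2 + Polynomial.monom b4 1)"
  have b1: "b1 \<noteq> 0" using False by (simp add: b1_def)
  have "Polynomial.degree (Polynomial.monom \<beta> (?q + 2)
    + Polynomial.monom c (?q + 1) + Polynomial.monom b2 (2 * ?q) + Polynomial.monom b2 ?q
    + Polynomial.monom b3 0 + Polynomial.monom b3 1 + Polynomial.monom b3 ?q
    + Polynomial.monom b4 2 + Polynomial.monom b4 1) \<le> 2 * ?q"
    using q by (intro degree_add_le order.trans[OF degree_monom_le]) auto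
  then have deg: "Polynomial.degree P = 2 * ?q + 1"
    unfolding P_def using b1 by (subst degree_add_eq_left) (auto simp: degree_monom_eq)
  then have P: "P \<noteq> 0" by auto
  have "poly P y = 0" if y: "y \<in> frob.pentagon" and 0: "c + tr (\<beta> * y) = 0" for y
  proof -
    define y1 y2 y3 y4 where "y1 = frob y" and "y2 = frob y1" and "y3 = frob y2" and "y4 = frob y3"
    have rel: "y * y2 = y1 + 1" "y * y1 * y3 = y + y1 + 1" "y1 * y4 = y + 1"
      using frob.pentagonD[OF y] frob.pentagon_orbit(1,2)[OF y]
      by (simp_all add: y1_def y2_def y3_def y4_def)
    have "c + (\<beta> * y + b1 * y1 + b2 * y2 + b3 * y3 + b4 * y4) = 0"
      using 0 by (simp add: tr_def frob.s_mult b1_def b2_def b3_def b4_def y1_def y2_def y3_def y4_def)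
    then have "y * y1 * (c + (\<beta> * y + b1 * y1 + b2 * y2 + b3 * y3 + b4 * y4)) = 0" by simp
    moreover have "y * y1 * (c + (\<beta> * y + b1 * y1 + b2 * y2 + b3 * y3 + b4 * y4))
      = y * y1 * (c + \<beta> * y + b1 * y1) + b2 * y1 * (y * y2) + b3 * (y * y1 * y3) + b4 * y * (y1 * y4)"
      by (simp add: algebra_simps)
    ultimately have "y * y1 * (c + \<beta> * y + b1 * y1) + b2 * y1 * (y1 + 1) + b3 * (y + y1 + 1)
        + b4 * y * (y + 1) = 0"
      by (simp only: rel)
    moreover have "y ^ (2 * ?q) = y1 * y1" "y ^ ?q = y1"
      by (simp_all add: y1_def frob_def power2_eq_square power_mult power_mult_distrib mult.commute[of 2])
    ultimately show "poly P y = 0"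
      by (simp add: P_def poly_monom power_add power2_eq_square algebra_simps)
  qed
  then have "card {y \<in> frob.pentagon. c + tr (\<beta> * y) = 0} \<le> card {y. poly P y = 0}"
    using poly_roots_finite[OF P] by (intro card_mono) auto
  then show ?thesis using card_poly_roots_bound[OF P] deg by simp
qed

subsection \<open>The projective point set\<close>

text \<open>\<open>E c w\<close> has homogenising coordinate \<open>c\<close> and affine part
  \<open>w\<close>, so \<open>E 1\<close> embeds \<open>quintic\<close> as affine 5-space.
  \<open>E_linear_form\<close> rewrites linear forms as trace equations.\<close>

locale affine_embedding =
  fixes E :: "'a::{finite,field} \<Rightarrow> 'a alg_closure \<Rightarrow> 'a ^ 6"
  assumes E_add: "v \<in> quintic \<Longrightarrow> w \<in> quintic \<Longrightarrow> E (c + d) (v + w) = E c v + E d w"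
    and E_scale: "w \<in> quintic \<Longrightarrow> E (a * c) (to_ac a * w) = a *s E c w"
    and E_eq_0D: "w \<in> quintic \<Longrightarrow> E c w = 0 \<Longrightarrow> c = 0 \<and> w = 0"
    and E_nth_0: "E c w $ 0 = c"
    and E_linear_form: "h \<noteq> 0 \<Longrightarrow> \<exists>\<beta>. (\<beta> \<noteq> 0 \<or> h $ 0 \<noteq> 0) \<and>
      (\<forall>c. \<forall>w\<in>quintic. to_ac (\<Sum>k\<in>UNIV. h $ k * E c w $ k) = to_ac (h $ 0 * c) + tr (\<beta> * w))"

lemma exists_affine_embedding: "\<exists>E :: 'a::{finite,field} \<Rightarrow> _. affine_embedding E"
proof -
  let ?I = "UNIV - {0 :: 6}"
  have "card ?I = 5" by (simp add: card_Diff_singleton)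
  then obtain b :: "6 \<Rightarrow> 'a alg_closure"
    where b: "\<And>k. k \<in> ?I \<Longrightarrow> b k \<in> quintic"
      and nondeg: "\<And>w. w \<in> quintic \<Longrightarrow> (\<And>k. k \<in> ?I \<Longrightarrow> tr (b k * w) = 0) \<Longrightarrow> w = 0"
      and ind: "\<And>h k. (\<Sum>k\<in>?I. to_ac (h k) * b k) = 0 \<Longrightarrow> k \<in> ?I \<Longrightarrow> h k = 0"
    by (rule quintic_basis) blast
  define E where "E = (\<lambda>c w. (\<chi> k. if k = 0 then c else of_ac (tr (b k * w))) :: 'a ^ 6)"
  have of_ac: "to_ac (of_ac (tr (b k * w))) = tr (b k * w)" if "k \<noteq> 0" "w \<in> quintic" for k w
    using that b by (intro to_ac_of_ac tr_in_range quintic_closed) auto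
  have "affine_embedding E"
  proof
    fix c d and v w :: "'a alg_closure" assume vw: "v \<in> quintic" "w \<in> (quintic :: 'a alg_closure set)"
    have "of_ac (tr (b k * (v + w))) = of_ac (tr (b k * v)) + of_ac (tr (b k * w))" if "k \<noteq> 0" for k
      by (rule of_ac_eqI) (simp add: of_ac that vw tr_add distrib_left)
    then show "E (c + d) (v + w) = E c v + E d w"
      by (simp add: E_def vec_eq_iff)
  next
    fix a c w assume w: "w \<in> (quintic :: 'a alg_closure set)"
    have "of_ac (tr (b k * (to_ac a * w))) = a * of_ac (tr (b k * w))" if "k \<noteq> 0" for k
    proof (rule of_ac_eqI)
      have "b k * (to_ac a * w) = to_ac a * (b k * w)" by (simp add: mult_ac)
      then show "to_ac (a * of_ac (tr (b k * w))) = tr (b k * (to_ac a * w))"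
        by (simp only: tr_scale to_ac_mult of_ac[OF that w])
    qed
    then show "E (a * c) (to_ac a * w) = a *s E c w"
      by (simp add: E_def vec_eq_iff)
  next
    fix c w assume w: "w \<in> (quintic :: 'a alg_closure set)" and 0: "E c w = 0"
    have "of_ac (tr (b k * w)) = 0" if "k \<noteq> 0" for k
      using arg_cong[OF 0, of "\<lambda>v. v $ k"] that by (simp add: E_def)
    then have "tr (b k * w) = 0" if "k \<noteq> 0" for k
      using of_ac[OF that w] that by simp
    then have "w = 0" using nondeg[OF w] by blast
    then show "c = 0 \<and> w = 0" using arg_cong[OF 0, of "\<lambda>v. v $ 0"] by (simp add: E_def)
  next
    show "E c w $ 0 = c" for c w by (simp add: E_def)
  next
    fix h :: "'a ^ 6" assume h: "h \<noteq> 0"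
    \<comment> \<open>Pairing coefficients with the trace coordinates is the trace against this
      combination of the basis.\<close>
    define \<beta> where "\<beta> = (\<Sum>k\<in>?I. to_ac (h $ k) * b k)"
    have "\<beta> \<noteq> 0 \<or> h $ 0 \<noteq> 0"
    proof (rule ccontr)
      assume "\<not> ?thesis"
      then have "h $ k = 0" for k
        using ind[of "\<lambda>k. h $ k" k] by (cases "k = 0") (auto simp: \<beta>_def)
      with h show False by (simp add: vec_eq_iff)
    qed
    moreover have "to_ac (\<Sum>k\<in>UNIV. h $ k * E c w $ k) = to_ac (h $ 0 * c) + tr (\<beta> * w)"
      if w: "w \<in> quintic" for c w
    proof -
      have "to_ac (\<Sum>k\<in>UNIV. h $ k * E c w $ k)
          = to_ac (h $ 0 * c) + (\<Sum>k\<in>?I. to_ac (h $ k * E c w $ k))"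
        by (simp add: to_ac_sum sum.remove[of UNIV 0] E_def)
      also have "(\<Sum>k\<in>?I. to_ac (h $ k * E c w $ k)) = (\<Sum>k\<in>?I. tr (to_ac (h $ k) * b k * w))"
        using w by (intro sum.cong) (auto simp: E_def of_ac tr_scale mult.assoc)
      also have "\<dots> = tr (\<beta> * w)" by (simp add: \<beta>_def sum_distrib_right tr_sum)
      finally show ?thesis .
    qed
    ultimately show "\<exists>\<beta>. (\<beta> \<noteq> 0 \<or> h $ 0 \<noteq> 0) \<and>
      (\<forall>c. \<forall>w\<in>quintic. to_ac (\<Sum>k\<in>UNIV. h $ k * E c w $ k) = to_ac (h $ 0 * c) + tr (\<beta> * w))"
      by blast
  qed
  then show ?thesis by blast
qed

section \<open>Spans of embedded points and chord relations over the base field\<close>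

context affine_embedding
begin

abbreviation pent :: "'a alg_closure set" where "pent \<equiv> frob.pentagon"

abbreviation pt :: "'a alg_closure \<Rightarrow> 'a ^ 6" where "pt \<equiv> E 1"

lemma pent_quintic: "y \<in> pent \<Longrightarrow> y \<in> quintic"
  using pentagon_subset_quintic by blast

lemma finite_pent: "finite pent"
  using finite_quintic pentagon_subset_quintic finite_subset by blast

lemma E_eq_iff:
  assumes "v \<in> quintic" "w \<in> quintic"
  shows "E c v = E d w \<longleftrightarrow> c = d \<and> v = w"
proof -
  have "E (c - d) (v - w) = E c v - E d w"
    using E_add[of "v - w" w "c - d" d] assms by (simp add: quintic_closed algebra_simps)
  then show ?thesis
    using E_eq_0D[of "v - w" "c - d"] assms by (auto simp: quintic_closed)
qed

lemma scale_pt: "y \<in> quintic \<Longrightarrow> a *s pt y = E a (to_ac a * y)"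
  using E_scale[of y a 1] by simp

lemma pt_comb4:
  assumes "p \<in> quintic" "q \<in> quintic" "r \<in> quintic" "t \<in> quintic"
  shows "a *s pt p + b *s pt q + c *s pt r + d *s pt t
    = E (a + b + c + d) (to_ac a * p + to_ac b * q + to_ac c * r + to_ac d * t)"
  using assms by (simp add: scale_pt E_add quintic_closed)

lemma indep3_to_acD:
  assumes "p \<in> pent" "q \<in> pent" "r \<in> pent" "t \<in> pent" "distinct [p, q, r, t]"
    and "to_ac a * (q - p) + to_ac b * (r - p) + to_ac c * (t - p) = 0"
  shows "a = 0 \<and> b = 0 \<and> c = 0"
  using frob.pentagon_indep3[OF assms(1-5), unfolded frob.indep3_def, rule_format,
      of "to_ac a" "to_ac b" "to_ac c"] assms(6) by simp

lemma independent_pt4: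
  assumes mem: "p \<in> pent" "q \<in> pent" "r \<in> pent" "t \<in> pent" and dist: "distinct [p, q, r, t]"
  shows "vec.independent {pt p, pt q, pt r, pt t}" "card {pt p, pt q, pt r, pt t} = 4"
proof -
  have inj: "pt x = pt y \<longleftrightarrow> x = y" if "x \<in> pent" "y \<in> pent" for x y
    using that by (simp add: E_eq_iff pent_quintic)
  have dist': "distinct [pt p, pt q, pt r, pt t]" using dist mem by (simp add: inj)
  then show "card {pt p, pt q, pt r, pt t} = 4" by simp
  show "vec.independent {pt p, pt q, pt r, pt t}"
  proof
    assume "vec.dependent {pt p, pt q, pt r, pt t}"
    then obtain u where u: "\<exists>v\<in>{pt p, pt q, pt r, pt t}. u v \<noteq> 0"
      and sum: "(\<Sum>v\<in>{pt p, pt q, pt r, pt t}. u v *s v) = 0"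
      by (auto simp only: vec.dependent_finite finite.intros)
    let ?a = "u (pt p)" and ?b = "u (pt q)" and ?c = "u (pt r)" and ?d = "u (pt t)"
    have "?a *s pt p + ?b *s pt q + ?c *s pt r + ?d *s pt t = 0"
      using sum dist' by (simp add: add.assoc)
    then have "E (?a + ?b + ?c + ?d) (to_ac ?a * p + to_ac ?b * q + to_ac ?c * r + to_ac ?d * t) = 0"
      using pt_comb4 mem by (simp add: pent_quintic)
    moreover have "to_ac ?a * p + to_ac ?b * q + to_ac ?c * r + to_ac ?d * t \<in> quintic"
      using mem by (intro quintic_closed pent_quintic)
    ultimately have 0: "?a + ?b + ?c + ?d = 0"
      "to_ac ?a * p + to_ac ?b * q + to_ac ?c * r + to_ac ?d * t = 0"
      using E_eq_0D by blast+
    \<comment> \<open>The homogenising coordinate makes the coefficients sum to 0, so the relation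
      is one between chords at \<open>p\<close>.\<close>
    from 0(1) have a: "?a = - ?b - ?c - ?d" by (simp add: algebra_simps eq_neg_iff_add_eq_0)
    have "to_ac ?b * (q - p) + to_ac ?c * (r - p) + to_ac ?d * (t - p) = 0"
      using 0(2) unfolding a by (simp add: algebra_simps)
    then have "?b = 0 \<and> ?c = 0 \<and> ?d = 0" by (rule indep3_to_acD[OF mem dist])
    with a u show False by auto
  qed
qed

text \<open>All points have homogenising coordinate 1, so the coefficients in the span sum to 1 and
  describe an affine combination based at \<open>p\<close>.\<close>

lemma pt_in_span4_iff:
  assumes mem: "p \<in> pent" "q \<in> pent" "r \<in> pent" "t \<in> pent" "y \<in> quintic" and dist: "distinct [p, q, r, t]"
  shows "pt y \<in> vec.span {pt p, pt q, pt r, pt t} \<longleftrightarrow>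
    (\<exists>b c d. y - p = to_ac b * (q - p) + to_ac c * (r - p) + to_ac d * (t - p))"
    (is "?l \<longleftrightarrow> ?r")
proof
  have dist': "distinct [pt p, pt q, pt r, pt t]"
    using independent_pt4(2)[OF mem(1-4) dist] card_distinct[of "[pt p, pt q, pt r, pt t]"] by simp
  note mem' = mem(1-4)[THEN pent_quintic]
  assume ?l
  then obtain u where "pt y = (\<Sum>v\<in>{pt p, pt q, pt r, pt t}. u v *s v)"
    by (auto simp only: vec.span_finite finite.intros)
  then have "\<exists>a b c d. pt y = a *s pt p + b *s pt q + c *s pt r + d *s pt t"
    using dist' by (auto simp: add.assoc)
  then obtain a b c d where "pt y = a *s pt p + b *s pt q + c *s pt r + d *s pt t" by blast
  then have eq: "1 = a + b + c + d" "y = to_ac a * p + to_ac b * q + to_ac c * r + to_ac d * t"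
    using mem mem' by (auto simp: pt_comb4 E_eq_iff quintic_closed)
  from eq(1) have a: "a = 1 - b - c - d" by (simp add: algebra_simps)
  have "y - p = to_ac b * (q - p) + to_ac c * (r - p) + to_ac d * (t - p)"
    unfolding eq(2) a by (simp add: algebra_simps)
  then show ?r by blast
next
  note mem' = mem(1-4)[THEN pent_quintic]
  assume ?r
  then obtain b c d where y: "y - p = to_ac b * (q - p) + to_ac c * (r - p) + to_ac d * (t - p)" by blast
  have "y = (y - p) + p" by simp
  also have "\<dots> = to_ac (1 - b - c - d) * p + to_ac b * q + to_ac c * r + to_ac d * t"
    unfolding y by (simp add: algebra_simps)
  finally have "pt y = (1 - b - c - d) *s pt p + b *s pt q + c *s pt r + d *s pt t"
    using pt_comb4[OF mem', of "1 - b - c - d" b c d] by simp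
  then show ?l
    by (simp only:) (intro vec.span_add vec.span_scale vec.span_base; simp)
qed

text \<open>\<open>pentagon_solid\<close> identifies \<open>y\<close> and \<open>z\<close>. It needs
  non-zero coefficients: a zero one would make the extra point coplanar with \<open>p\<close> and
  two of \<open>q\<close>, \<open>r\<close>, \<open>t\<close>.\<close>

lemma pt_six_not_in_solid:
  assumes mem: "p \<in> pent" "q \<in> pent" "r \<in> pent" "t \<in> pent" "y \<in> pent" "z \<in> pent"
    and dist: "distinct [p, q, r, t, y, z]"
    and y: "pt y \<in> vec.span {pt p, pt q, pt r, pt t}"
  shows "pt z \<notin> vec.span {pt p, pt q, pt r, pt t}"
proof
  assume z: "pt z \<in> vec.span {pt p, pt q, pt r, pt t}"
  have dist4: "distinct [p, q, r, t]" using dist by simp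
  obtain b c d where bcd: "y - p = to_ac b * (q - p) + to_ac c * (r - p) + to_ac d * (t - p)"
    using y pt_in_span4_iff[OF mem(1-4) _ dist4] mem(5) pent_quintic by blast
  obtain b' c' d' where bcd': "z - p = to_ac b' * (q - p) + to_ac c' * (r - p) + to_ac d' * (t - p)"
    using z pt_in_span4_iff[OF mem(1-4) _ dist4] mem(6) pent_quintic by blast
  have nz: "b \<noteq> 0 \<and> c \<noteq> 0 \<and> d \<noteq> 0"
    if "x \<in> pent" "x \<notin> {p, q, r, t}"
      and x: "x - p = to_ac b * (q - p) + to_ac c * (r - p) + to_ac d * (t - p)" for x b c d
  proof -
    have *: "\<not> (x - p = to_ac a * (u - p) + to_ac a' * (v - p))"
      if "u \<in> pent" "v \<in> pent" "distinct [p, u, v, x]" for u v a a'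
    proof
      assume "x - p = to_ac a * (u - p) + to_ac a' * (v - p)"
      then have "to_ac a * (u - p) + to_ac a' * (v - p) + to_ac (- 1) * (x - p) = 0" by simp
      from indep3_to_acD[OF mem(1) that(1,2) \<open>x \<in> pent\<close> that(3) this] show False by simp
    qed
    show ?thesis
      using x *[of r t c d] *[of q t b d] *[of q r b c] mem that dist by auto
  qed
  have "b \<noteq> 0 \<and> c \<noteq> 0 \<and> d \<noteq> 0" using nz[OF mem(5) _ bcd] dist by auto
  moreover have "b' \<noteq> 0 \<and> c' \<noteq> 0 \<and> d' \<noteq> 0" using nz[OF mem(6) _ bcd'] dist by auto
  moreover have "frob.indep3 (q - p) (r - p) (t - p)"
    by (rule frob.pentagon_indep3[OF mem(1-4) dist4])
  ultimately have "to_ac b = to_ac b' \<and> to_ac c = to_ac c' \<and> to_ac d = to_ac d'"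
    using mem by (intro frob.pentagon_solid[of p "q - p" "r - p" "t - p"])
      (auto simp flip: bcd bcd')
  then have "y - p = z - p" using bcd bcd' by simp
  then show False using dist by simp
qed

lemma span_pt_eq_UNIV:
  assumes T: "T \<subseteq> pent" "finite T" "card T > 2 * CARD('a) + 1" and q: "CARD('a) \<ge> 3"
  shows "vec.span (pt ` T) = UNIV"
proof (rule ccontr)
  assume "vec.span (pt ` T) \<noteq> UNIV"
  then obtain h :: "'a ^ 6" where h: "h \<noteq> 0"
    "\<And>v. v \<in> vec.span (pt ` T) \<Longrightarrow> (\<Sum>k\<in>UNIV. h $ k * v $ k) = 0"
    using proper_subspace_linear_form[OF vec.subspace_span] by blast
  obtain \<beta> where b: "\<beta> \<noteq> 0 \<or> h $ 0 \<noteq> 0"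
    and form: "\<forall>c. \<forall>w\<in>quintic. to_ac (\<Sum>k\<in>UNIV. h $ k * E c w $ k) = to_ac (h $ 0 * c) + tr (\<beta> * w)"
    using E_linear_form[OF h(1)] by blast
  have "T \<subseteq> {y \<in> pent. to_ac (h $ 0) + tr (\<beta> * y) = 0}"
  proof
    fix y assume y: "y \<in> T"
    then have "y \<in> pent" using T by blast
    moreover have "to_ac (h $ 0 * 1) + tr (\<beta> * y) = to_ac 0"
      using form[rule_format, OF pent_quintic[OF \<open>y \<in> pent\<close>], of 1]
        h(2)[OF vec.span_base[OF imageI[OF y]]] by simp
    ultimately show "y \<in> {y \<in> pent. to_ac (h $ 0) + tr (\<beta> * y) = 0}" by simp
  qed
  then have "card T \<le> card {y \<in> pent. to_ac (h $ 0) + tr (\<beta> * y) = 0}"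
    using finite_pent by (intro card_mono) auto
  also have "\<dots> \<le> 2 * CARD('a) + 1"
    by (rule hyperplane_section_bound[OF q]) (use b in simp)
  finally show False using T(3) by simp
qed

text \<open>With the chord to \<open>x\<close> shared, at most three chords occur, and these are
  independent. This excludes partial coincidences in the pigeonhole argument for solids.\<close>

lemma two_chord_comb_eq:
  assumes mem: "p \<in> pent" "x \<in> pent" "y \<in> pent" "z \<in> pent"
    and dist: "x \<noteq> p" "y \<noteq> p" "z \<noteq> p" "x \<noteq> y" "x \<noteq> z" and nz: "b \<noteq> 0"
    and eq: "to_ac a * (x - p) + to_ac b * (y - p) = to_ac a' * (x - p) + to_ac b' * (z - p)"
  shows "y = z \<and> a = a' \<and> b = b'"
proof -
  have yz: "y = z"
  proof (rule ccontr)
    assume "y \<noteq> z"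
    have "to_ac (a - a') * (x - p) + to_ac b * (y - p) + to_ac (- b') * (z - p) = 0"
      using eq by (simp add: algebra_simps)
    moreover have "distinct [p, x, y, z]" using dist \<open>y \<noteq> z\<close> by auto
    ultimately show False using indep3_to_acD[OF mem] nz by blast
  qed
  have "to_ac (a - a') * (x - p) + to_ac (b - b') * (y - p) = 0"
    using eq unfolding yz by (simp add: algebra_simps)
  moreover have "frob.indep2 (x - p) (y - p)"
    by (rule frob.pentagon_indep2) (use mem dist in auto)
  ultimately have "to_ac (a - a') = 0 \<and> to_ac (b - b') = 0"
    using frob_to_ac unfolding frob.indep2_def by blast
  then show ?thesis using yz by simp
qed

text \<open>There are too many combinations of two chords through a point for all coincidences to come
  from swapping the chords.\<close>

lemma five_in_solid:
  assumes q: "CARD('a) \<ge> 4"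
  obtains p x y z t where "p \<in> pent" "x \<in> pent" "y \<in> pent" "z \<in> pent" "t \<in> pent"
    "distinct [p, x, y, z, t]" "pt t \<in> vec.span {pt p, pt x, pt y, pt z}"
proof -
  let ?q = "CARD('a)"
  have card: "card pent = ?q ^ 2 + 1" by (rule card_frob_pentagon)
  then obtain p where p: "p \<in> pent" by fastforce
  \<comment> \<open>Ordered pairs of distinct chords with non-zero coefficients, so each combination
    is counted twice.\<close>
  define A where "A = (SIGMA x:pent - {p}. SIGMA y:pent - {p, x}. (UNIV - {0 :: 'a}) \<times> (UNIV - {0 :: 'a}))"
  define f where "f = (\<lambda>(x, y, a, b). to_ac a * (x - p) + to_ac b * (y - p))"
  have finA: "finite A" unfolding A_def using finite_pent by (intro finite_SigmaI finite_Diff) auto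
  have cU: "card (UNIV - {0 :: 'a}) = ?q - 1" by (simp add: card_Diff_singleton)
  have c2: "card (pent - {p, x}) = ?q ^ 2 - 1" if "x \<in> pent - {p}" for x
    using that p finite_pent card by (subst card_Diff_subset) auto
  have cS: "card (SIGMA y:pent - {p, x}. (UNIV - {0 :: 'a}) \<times> (UNIV - {0 :: 'a}))
      = (?q ^ 2 - 1) * ((?q - 1) * (?q - 1))" if "x \<in> pent - {p}" for x
    using that finite_pent c2[OF that] by (simp add: card_cartesian_product cU)
  have cardA: "card A = ?q ^ 2 * ((?q ^ 2 - 1) * ((?q - 1) * (?q - 1)))"
  proof -
    have "card A = (\<Sum>x\<in>pent - {p}. card (SIGMA y:pent - {p, x}. (UNIV - {0 :: 'a}) \<times> (UNIV - {0 :: 'a})))"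
      unfolding A_def using finite_pent by (intro card_SigmaI) (auto intro!: finite_SigmaI)
    also have "\<dots> = (\<Sum>x\<in>pent - {p}. (?q ^ 2 - 1) * ((?q - 1) * (?q - 1)))"
      by (rule sum.cong[OF refl cS])
    also have "\<dots> = ?q ^ 2 * ((?q ^ 2 - 1) * ((?q - 1) * (?q - 1)))"
      using p card by (simp add: card_Diff_singleton)
    finally show ?thesis .
  qed
  have fA: "f \<in> A \<rightarrow> quintic"
    using p by (auto simp: A_def f_def simp: quintic_closed pent_quintic)
  obtain w where w: "w \<in> quintic" "card (f -` {w} \<inter> A) * ?q ^ 5 \<ge> card A"
    using pigeonhole_card[OF fA finA finite_quintic] quintic_closed(6) card_quintic by (metis empty_iff)
  \<comment> \<open>A third element of the fibre is needed, since swapping the chords already yields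
    a second one.\<close>
  have "card (f -` {w} \<inter> A) > 2"
  proof (rule ccontr)
    assume "\<not> card (f -` {w} \<inter> A) > 2"
    then have "card (f -` {w} \<inter> A) * ?q ^ 5 \<le> 2 * ?q ^ 5" by (intro mult_right_mono) auto
    with w(2) cardA have "?q ^ 2 * ((?q ^ 2 - 1) * ((?q - 1) * (?q - 1))) \<le> 2 * ?q ^ 5" by linarith
    also have "\<dots> = ?q ^ 2 * (2 * ?q ^ 3)" by (simp add: eval_nat_numeral algebra_simps)
    finally have le: "(?q ^ 2 - 1) * ((?q - 1) * (?q - 1)) \<le> 2 * ?q ^ 3" by simp
    \<comment> \<open>Substituting \<open>q = n + 4\<close> leaves a difference with positive
      coefficients. At \<open>q = 4\<close> the margin is 135 against 128; for \<open>q = 3\<close>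
      the inequality \<open>le\<close> would hold.\<close>
    obtain n where n: "?q = n + 4" using q by (metis add.commute le_Suc_ex)
    have "(?q ^ 2 - 1) = n ^ 2 + 8 * n + 15" unfolding n by (simp add: power2_eq_square algebra_simps)
    then have "(n ^ 2 + 8 * n + 15) * ((n + 3) * (n + 3)) \<le> 2 * (n + 4) ^ 3"
      using le unfolding n by (simp add: add.commute)
    moreover have "(n ^ 2 + 8 * n + 15) * ((n + 3) * (n + 3))
        = 2 * (n + 4) ^ 3 + (n ^ 4 + 12 * n ^ 3 + 48 * n ^ 2 + 66 * n + 7)"
      by Groebner_Basis.algebra
    ultimately show False by linarith
  qed
  then have "f -` {w} \<inter> A \<noteq> {}" by fastforce
  then obtain x y a b where 1: "(x, y, a, b) \<in> A" "f (x, y, a, b) = w" by (auto simp del: f_def)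
  have "\<not> f -` {w} \<inter> A \<subseteq> {(x, y, a, b), (y, x, b, a)}"
  proof
    assume "f -` {w} \<inter> A \<subseteq> {(x, y, a, b), (y, x, b, a)}"
    from card_mono[OF _ this] have "card (f -` {w} \<inter> A) \<le> card {(x, y, a, b), (y, x, b, a)}" by simp
    moreover have "card {m, n} \<le> 2" for m n :: "'a alg_closure \<times> 'a alg_closure \<times> 'a \<times> 'a"
      by (simp add: card_insert_if)
    ultimately show False using \<open>card (f -` {w} \<inter> A) > 2\<close> by (meson not_le order.trans)
  qed
  then obtain z t c d where 2: "(z, t, c, d) \<in> A" "f (z, t, c, d) = w"
    "(z, t, c, d) \<noteq> (x, y, a, b)" "(z, t, c, d) \<noteq> (y, x, b, a)" by auto
  have mem: "x \<in> pent" "y \<in> pent" "z \<in> pent" "t \<in> pent"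
    and ne: "x \<noteq> p" "y \<noteq> p" "z \<noteq> p" "t \<noteq> p" "x \<noteq> y" "z \<noteq> t"
    and nz: "a \<noteq> 0" "b \<noteq> 0" "c \<noteq> 0" "d \<noteq> 0"
    using 1(1) 2(1) by (auto simp: A_def)
  have eq: "to_ac a * (x - p) + to_ac b * (y - p) = to_ac c * (z - p) + to_ac d * (t - p)"
    using 1(2) 2(2) by (simp add: f_def)
  \<comment> \<open>The reorderings bring a shared chord to the front on both sides, so that
    \<open>two_chord_comb_eq\<close> excludes each of the four possible common endpoints.\<close>
  note eq1 = eq[unfolded add.commute[of "to_ac a * (x - p)"]]
    and eq2 = eq[unfolded add.commute[of "to_ac c * (z - p)"]]
  note eq3 = eq1[unfolded add.commute[of "to_ac c * (z - p)"]]
  have "z \<noteq> x"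
  proof
    assume "z = x"
    note two_chord_comb_eq[OF p mem(1,2,4) ne(1,2,4,5) ne(6)[unfolded \<open>z = x\<close>] nz(2)
        eq[unfolded \<open>z = x\<close>]]
    with 2(3) \<open>z = x\<close> show False by simp
  qed
  moreover have "z \<noteq> y"
  proof
    assume "z = y"
    note two_chord_comb_eq[OF p mem(2,1,4) ne(2,1,4) ne(5)[symmetric] ne(6)[unfolded \<open>z = y\<close>] nz(1)
        eq1[unfolded \<open>z = y\<close>]]
    with 2(4) \<open>z = y\<close> show False by simp
  qed
  moreover have "t \<noteq> x"
  proof
    assume "t = x"
    note two_chord_comb_eq[OF p mem(1,2,3) ne(1,2,3,5) ne(6)[symmetric, unfolded \<open>t = x\<close>] nz(2)
        eq2[unfolded \<open>t = x\<close>]]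
    with 2(4) \<open>t = x\<close> show False by simp
  qed
  moreover have "t \<noteq> y"
  proof
    assume "t = y"
    note two_chord_comb_eq[OF p mem(2,1,3) ne(2,1,3) ne(5)[symmetric]
        ne(6)[symmetric, unfolded \<open>t = y\<close>] nz(1) eq3[unfolded \<open>t = y\<close>]]
    with 2(3) \<open>t = y\<close> show False by simp
  qed
  ultimately have dist: "distinct [p, x, y, z, t]" using ne by auto
  then have dist4: "distinct [p, x, y, z]" by simp
  have "to_ac d * (t - p) = to_ac d * (to_ac (a / d) * (x - p) + to_ac (b / d) * (y - p) + to_ac (- c / d) * (z - p))"
    using eq nz by (simp add: distrib_left algebra_simps)
  then have "t - p = to_ac (a / d) * (x - p) + to_ac (b / d) * (y - p) + to_ac (- c / d) * (z - p)"
    using nz by simp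
  then have "pt t \<in> vec.span {pt p, pt x, pt y, pt z}"
    using pt_in_span4_iff[OF p mem(1-3) pent_quintic[OF mem(4)] dist4] by blast
  then show ?thesis using that p mem dist by blast
qed

text \<open>Each of the \<open>q^2 - 4\<close> points outside the five, with a non-zero multiple of
  its chord plus a direction of the solid, gives an element of \<open>quintic\<close>. As
  \<open>(q^2 - 4) * (q - 1) * q^3 > q^5\<close>, two coincide, so two such points span the same
  hyperplane with the solid.\<close>

lemma seven_in_hyperplane:
  assumes q: "CARD('a) \<ge> 4"
    and mem: "p \<in> pent" "x \<in> pent" "y \<in> pent" "z \<in> pent" "t \<in> pent"
    and dist: "distinct [p, x, y, z, t]" and t: "pt t \<in> vec.span {pt p, pt x, pt y, pt z}"
  obtains u v where "u \<in> pent" "v \<in> pent" "distinct [p, x, y, z, t, u, v]"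
    "pt v \<in> vec.span {pt u, pt p, pt x, pt y, pt z}"
proof -
  let ?q = "CARD('a)"
  define S where "S = pent - {p, x, y, z, t}"
  have dist4: "distinct [p, x, y, z]" using dist by simp
  have "card {p, x, y, z, t} = 5" using dist by simp
  then have cS: "card S = ?q ^ 2 - 4"
    unfolding S_def using mem finite_pent by (subst card_Diff_subset) (auto simp: card_frob_pentagon)
  define A where "A = S \<times> (UNIV - {0 :: 'a}) \<times> (UNIV :: 'a set) \<times> (UNIV :: 'a set) \<times> (UNIV :: 'a set)"
  define f where "f = (\<lambda>(u, a, b, c, d). to_ac a * (u - p) + (to_ac b * (x - p) + to_ac c * (y - p) + to_ac d * (z - p)))"
  have "card A = (?q ^ 2 - 4) * ((?q - 1) * (?q * (?q * ?q)))"
    by (simp add: A_def card_cartesian_product cS card_Diff_singleton)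
  moreover have "?q ^ 5 < (?q ^ 2 - 4) * ((?q - 1) * (?q * (?q * ?q)))"
  proof -
    obtain n where n: "?q = n + 4" using q by (metis add.commute le_Suc_ex)
    have "(?q ^ 2 - 4) = n ^ 2 + 8 * n + 12" unfolding n by (simp add: power2_eq_square algebra_simps)
    then have "?q ^ 2 < (?q ^ 2 - 4) * (?q - 1)" unfolding n by (simp add: power2_eq_square algebra_simps)
    then have "?q ^ 2 * ?q ^ 3 < (?q ^ 2 - 4) * (?q - 1) * ?q ^ 3"
      by (rule mult_strict_right_mono) simp
    moreover have "?q ^ 5 = ?q ^ 2 * ?q ^ 3" by (simp flip: power_add)
    ultimately show ?thesis by (simp only: power3_eq_cube mult.assoc)
  qed
  moreover have "f ` A \<subseteq> quintic"
    using mem by (auto simp: A_def S_def f_def simp: quintic_closed pent_quintic)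
  then have "card (f ` A) \<le> ?q ^ 5"
    using card_mono[OF finite_quintic] by (metis card_quintic)
  ultimately have "\<not> inj_on f A" by (intro pigeonhole) simp
  then obtain m n where mn: "m \<in> A" "n \<in> A" "m \<noteq> n" "f m = f n"
    unfolding inj_on_def by blast
  obtain u a b c d where m: "m = (u, a, b, c, d)" by (cases m)
  obtain v a' b' c' d' where n: "n = (v, a', b', c', d')" by (cases n)
  have uv: "u \<in> S" "v \<in> S" "a \<noteq> 0" "a' \<noteq> 0" "(u, a, b, c, d) \<noteq> (v, a', b', c', d')"
    and eq: "f (u, a, b, c, d) = f (v, a', b', c', d')"
    using mn unfolding m n by (auto simp: A_def)
  have eq': "to_ac a * (u - p) + (to_ac b * (x - p) + to_ac c * (y - p) + to_ac d * (z - p))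
    = to_ac a' * (v - p) + (to_ac b' * (x - p) + to_ac c' * (y - p) + to_ac d' * (z - p))"
    using eq by (simp add: f_def)
  have mem': "u \<in> pent" "v \<in> pent" using uv by (auto simp: S_def)
  have dist': "distinct [p, x, y, z, t, u]" using uv dist by (auto simp: S_def)
  \<comment> \<open>For equal points, \<open>a \<noteq> a'\<close> makes \<open>u\<close> a sixth
    point of the solid, and \<open>a = a'\<close> leaves a relation between three independent
    chords.\<close>
  have "u \<noteq> v"
  proof
    assume "u = v"
    have 0: "to_ac (a - a') * (u - p) = to_ac (b' - b) * (x - p) + to_ac (c' - c) * (y - p) + to_ac (d' - d) * (z - p)"
      using eq' unfolding \<open>u = v\<close> by (simp add: algebra_simps)
    have "a = a'"
    proof (rule ccontr)
      assume "a \<noteq> a'"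
      define m where "m = a - a'"
      have m: "m \<noteq> 0" using \<open>a \<noteq> a'\<close> by (simp add: m_def)
      have "to_ac m * (u - p) = to_ac m * (to_ac ((b' - b) / m) * (x - p)
          + to_ac ((c' - c) / m) * (y - p) + to_ac ((d' - d) / m) * (z - p))"
        using 0 m unfolding m_def[symmetric] by (simp add: distrib_left)
      then have "u - p = to_ac ((b' - b) / m) * (x - p)
          + to_ac ((c' - c) / m) * (y - p) + to_ac ((d' - d) / m) * (z - p)"
        using m by simp
      then have "pt u \<in> vec.span {pt p, pt x, pt y, pt z}"
        using pt_in_span4_iff[OF mem(1-4) pent_quintic[OF mem'(1)] dist4] by blast
      then show False using pt_six_not_in_solid[OF mem mem'(1) dist' t] by blast
    qed
    with 0 have "b' - b = 0 \<and> c' - c = 0 \<and> d' - d = 0"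
      by (intro indep3_to_acD[OF mem(1-4) dist4]) simp
    with \<open>a = a'\<close> \<open>u = v\<close> uv(5) show False by simp
  qed
  have "pt v \<in> vec.span {pt u, pt p, pt x, pt y, pt z}"
  proof -
    define k where "k = a / a'"
    \<comment> \<open>The point of the solid that remains when the multiple of \<open>u - p\<close>
      is split off from \<open>v - p\<close>.\<close>
    define w where "w = p + to_ac ((b - b') / a') * (x - p) + to_ac ((c - c') / a') * (y - p) + to_ac ((d - d') / a') * (z - p)"
    have w: "w \<in> quintic" unfolding w_def using mem by (intro quintic_closed pent_quintic)
    have "to_ac a' * (v - p) = to_ac a' * (to_ac k * (u - p) + (w - p))"
      using eq' uv by (simp add: k_def w_def distrib_left algebra_simps)
    then have v: "v - p = to_ac k * (u - p) + (w - p)" using uv by simp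
    have "v = (v - p) + p" by simp
    \<comment> \<open>The zero term pads the sum to the four summands of
      \<open>pt_comb4\<close>.\<close>
    also have "\<dots> = to_ac k * u + to_ac (- k) * p + to_ac 1 * w + to_ac 0 * p"
      unfolding v by (simp add: algebra_simps)
    finally have "pt v = k *s pt u + (- k) *s pt p + 1 *s pt w + 0 *s pt p"
      using pt_comb4[OF mem'(1)[THEN pent_quintic] mem(1)[THEN pent_quintic] w mem(1)[THEN pent_quintic], of k "- k" 1 0]
      by simp
    moreover have "pt w \<in> vec.span {pt p, pt x, pt y, pt z}"
      unfolding pt_in_span4_iff[OF mem(1-4) w dist4]
      by (intro exI[of _ "(b - b') / a'"] exI[of _ "(c - c') / a'"] exI[of _ "(d - d') / a'"])
        (simp add: w_def)
    then have "pt w \<in> vec.span {pt u, pt p, pt x, pt y, pt z}"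
      using vec.span_mono[of "{pt p, pt x, pt y, pt z}" "{pt u, pt p, pt x, pt y, pt z}"] by blast
    ultimately show ?thesis
      by (simp only:) (intro vec.span_add vec.span_scale; simp add: vec.span_base)
  qed
  moreover have "distinct [p, x, y, z, t, u, v]" using dist' \<open>u \<noteq> v\<close> uv(2) by (auto simp: S_def)
  ultimately show ?thesis using that mem' by blast
qed

section \<open>Projective points and bounds on plane and solid sections\<close>

lemma pt_nonzero: "y \<in> pent \<Longrightarrow> pt y \<noteq> 0"
  using E_nth_0[of 1 y] by auto

definition proj_pt :: "'a alg_closure \<Rightarrow> ('a ^ 6) set" where
  "proj_pt y = vec.span {pt y}"

lemma inj_on_proj_pt: "inj_on proj_pt pent"
proof
  fix x y assume xy: "x \<in> pent" "y \<in> pent" and eq: "proj_pt x = proj_pt y"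
  have "pt x \<in> vec.span {pt y}"
    using eq vec.span_base[of "pt x" "{pt x}"] by (simp add: proj_pt_def)
  then obtain k where k: "pt x = k *s pt y" by (auto simp: vec.span_singleton)
  from arg_cong[OF k, of "\<lambda>v. v $ 0"] have "k = 1" by (simp add: E_nth_0)
  with k show "x = y" using xy by (simp add: E_eq_iff pent_quintic)
qed

lemma proj_pt_subset_iff:
  "vec.subspace W \<Longrightarrow> proj_pt y \<subseteq> W \<longleftrightarrow> pt y \<in> W"
  unfolding proj_pt_def by (meson vec.span_minimal vec.span_base empty_subsetI insert_subset subsetD singletonI)

lemma points_in_proj_pt:
  assumes "T \<subseteq> pent" "vec.subspace W"
  shows "points_in (proj_pt ` T) W = card {y \<in> T. pt y \<in> W}"
proof -
  have "{P \<in> proj_pt ` T. P \<subseteq> W} = proj_pt ` {y \<in> T. pt y \<in> W}"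
    using proj_pt_subset_iff[OF assms(2)] by auto
  moreover have "inj_on proj_pt {y \<in> T. pt y \<in> W}"
    by (rule inj_on_subset[OF inj_on_proj_pt]) (use assms(1) in auto)
  ultimately show ?thesis by (simp add: points_in_def card_image)
qed

lemma proj_pt_points: "T \<subseteq> pent \<Longrightarrow> proj_pt ` T \<subseteq> proj_points"
  using pt_nonzero by (auto simp: proj_points_def proj_pt_def vec.dim_singleton)

lemma affine_proj_pt:
  assumes "T \<subseteq> pent"
  shows "affine_point_set (proj_pt ` T)"
proof -
  have "pt y \<in> proj_pt y" for y by (simp add: proj_pt_def vec.span_base)
  moreover have "pt y \<notin> hyperplane_at_infinity" for y
    by (simp add: hyperplane_at_infinity_def E_nth_0)
  ultimately show ?thesis
    using proj_pt_points[OF assms] unfolding affine_point_set_def by blast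
qed

lemma span_Union_proj_pt: "vec.span (\<Union>(proj_pt ` T)) = vec.span (pt ` T)"
proof (rule vec.span_eq[THEN iffD2], intro conjI subsetI)
  fix v assume "v \<in> \<Union>(proj_pt ` T)"
  then obtain y where "y \<in> T" "v \<in> vec.span {pt y}" by (auto simp: proj_pt_def)
  then show "v \<in> vec.span (pt ` T)" using vec.span_mono[of "{pt y}" "pt ` T"] by blast
next
  fix v assume "v \<in> pt ` T"
  then have "v \<in> \<Union>(proj_pt ` T)" by (auto simp: proj_pt_def intro: vec.span_base)
  then show "v \<in> vec.span (\<Union>(proj_pt ` T))" by (rule vec.span_base)
qed

lemma card_plane_section_le:
  assumes T: "T \<subseteq> pent" and W: "vec.subspace W" "vec.dim W = 3"
  shows "card {y \<in> T. pt y \<in> W} \<le> 3"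
proof (rule ccontr)
  assume "\<not> ?thesis"
  then obtain S where S: "S \<subseteq> {y \<in> T. pt y \<in> W}" "card S = 4"
    using obtain_subset_with_card_n[of 4 "{y \<in> T. pt y \<in> W}"] by auto
  then obtain p q r t where eq: "S = {p, q, r, t}" and dist: "distinct [p, q, r, t]"
    by (auto simp: card_Suc_eq eval_nat_numeral)
  have mem: "p \<in> pent" "q \<in> pent" "r \<in> pent" "t \<in> pent" using S T eq by auto
  have "{pt p, pt q, pt r, pt t} \<subseteq> W" using S eq by auto
  from vec.independent_card_le_dim[OF this independent_pt4(1)[OF mem dist]]
  show False using independent_pt4(2)[OF mem dist] W by simp
qed

text \<open>Four of six points already span the 4-dimensional \<open>W\<close>, so the other two lie
  in their span, against \<open>pt_six_not_in_solid\<close>.\<close>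

lemma card_solid_section_le:
  assumes T: "T \<subseteq> pent" and W: "vec.subspace W" "vec.dim W = 4"
  shows "card {y \<in> T. pt y \<in> W} \<le> 5"
proof (rule ccontr)
  assume "\<not> ?thesis"
  then obtain S where S: "S \<subseteq> {y \<in> T. pt y \<in> W}" "card S = 6"
    using obtain_subset_with_card_n[of 6 "{y \<in> T. pt y \<in> W}"] by auto
  then have "finite S" by (auto intro: card_ge_0_finite)
  then obtain xs where xs: "set xs = S" "distinct xs" using finite_distinct_list by blast
  then have "length xs = 6" using S(2) distinct_card by fastforce
  then obtain p q r t y z where "xs = [p, q, r, t, y, z]"
    by (auto simp: length_Suc_conv eval_nat_numeral)
  with xs have eq: "S = {p, q, r, t, y, z}" and dist: "distinct [p, q, r, t, y, z]" by auto
  have mem: "p \<in> pent" "q \<in> pent" "r \<in> pent" "t \<in> pent" "y \<in> pent" "z \<in> pent"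
    using S T eq by auto
  have dist4: "distinct [p, q, r, t]" using dist by simp
  have "{pt p, pt q, pt r, pt t} \<subseteq> W" using S eq by auto
  then have "W \<subseteq> vec.span {pt p, pt q, pt r, pt t}"
    using vec.card_eq_dim[of "{pt p, pt q, pt r, pt t}" W] independent_pt4[OF mem(1-4) dist4] W by simp
  then show False using pt_six_not_in_solid[OF mem dist] S eq by auto
qed

end

section \<open>Choice of the subset and verification of both properties\<close>

theorem mainTheorem12:
  fixes q :: nat
  assumes "CARD('a::{finite,field}) = q" and "q \<ge> 4"
  shows "\<exists>X :: ('a ^ 6) set set.
           affine_point_set X \<and> card X = q ^ 2 - q \<and> k_general 4 X \<and> rs_set 5 3 X"
proof -
  obtain E :: "'a \<Rightarrow> 'a alg_closure \<Rightarrow> 'a ^ 6" where "affine_embedding E"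
    using exists_affine_embedding by blast
  then interpret affine_embedding E .
  have q: "CARD('a) \<ge> 4" using assms by simp
  obtain p x y z t where mem: "p \<in> pent" "x \<in> pent" "y \<in> pent" "z \<in> pent" "t \<in> pent"
    and dist: "distinct [p, x, y, z, t]" and t: "pt t \<in> vec.span {pt p, pt x, pt y, pt z}"
    by (rule five_in_solid[OF q])
  obtain u v where mem': "u \<in> pent" "v \<in> pent" and dist': "distinct [p, x, y, z, t, u, v]"
    and v: "pt v \<in> vec.span {pt u, pt p, pt x, pt y, pt z}"
    by (rule seven_in_hyperplane[OF q mem dist t])
  have dist4: "distinct [p, x, y, z]" using dist by simp
  have dist6: "distinct [p, x, y, z, t, u]" using dist' by auto
  \<comment> \<open>The first bound makes \<open>T\<close> exceed every hyperplane section and hence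
    span; the other two leave room for \<open>T\<close> between the seven points and
    \<open>pent\<close>.\<close>
  have le: "2 * q + 1 < q ^ 2 - q" "7 \<le> q ^ 2 - q" "q ^ 2 - q \<le> q ^ 2 + 1"
  proof -
    obtain n where n: "q = n + 4" using assms(2) by (metis add.commute le_Suc_ex)
    have "q ^ 2 - q = n ^ 2 + 7 * n + 12" unfolding n by (simp add: power2_eq_square algebra_simps)
    then show "2 * q + 1 < q ^ 2 - q" "7 \<le> q ^ 2 - q" "q ^ 2 - q \<le> q ^ 2 + 1" using n by auto
  qed
  have "card {p, x, y, z, t, u, v} = 7" using dist' by simp
  then obtain T where T: "{p, x, y, z, t, u, v} \<subseteq> T" "T \<subseteq> pent" "card T = q ^ 2 - q"
    using exists_subset_between[of "{p, x, y, z, t, u, v}" "q ^ 2 - q" pent] mem mem' le finite_pent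
      card_frob_pentagon[where ?'a = 'a] assms(1) by auto
  have finT: "finite T" using T(2) finite_pent finite_subset by blast
  let ?X = "proj_pt ` T"
  have span: "vec.span (\<Union>?X) = UNIV"
    unfolding span_Union_proj_pt using T finT le assms q by (intro span_pt_eq_UNIV) auto
  \<comment> \<open>\<open>?S\<close> is a projective solid and \<open>?H\<close> a projective
    hyperplane. Their 5 = 3 + 2 and 7 = 5 + 2 points are the witnesses for the two existence
    conditions.\<close>
  let ?S = "vec.span {pt p, pt x, pt y, pt z}" and ?H = "vec.span {pt u, pt p, pt x, pt y, pt z}"
  have dimS: "vec.dim ?S = 4"
    by (rule trans[OF vec.dim_span_eq_card_independent independent_pt4(2)])
      (use independent_pt4(1)[OF mem(1-4) dist4] mem dist4 in simp_all)
  have "pt u \<notin> ?S" by (rule pt_six_not_in_solid[OF mem mem'(1) dist6 t])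
  then have dimH: "vec.dim ?H = 5"
    using dimS by (simp only: vec.dim_span vec.dim_insert[of "pt u"] if_False)
  have "{p, x, y, z, t} \<subseteq> {y \<in> T. pt y \<in> ?S}" using T(1) t by (auto intro: vec.span_base)
  then have "card {p, x, y, z, t} \<le> card {y \<in> T. pt y \<in> ?S}" using finT by (intro card_mono) auto
  then have five: "points_in ?X ?S \<ge> 5" using dist T(2) by (simp add: points_in_proj_pt)
  have "?S \<subseteq> ?H" by (rule vec.span_mono) auto
  then have "{p, x, y, z, t, u, v} \<subseteq> {y \<in> T. pt y \<in> ?H}"
    using T(1) t v by (auto intro: vec.span_base)
  then have "card {p, x, y, z, t, u, v} \<le> card {y \<in> T. pt y \<in> ?H}" using finT by (intro card_mono) auto
  then have seven: "points_in ?X ?H \<ge> 7" using dist' T(2) by (simp add: points_in_proj_pt)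
  have "k_general 4 ?X"
    unfolding k_general_def rs_set_def
  proof (intro conjI ballI bexI[of _ ?S])
    show "points_in ?X W \<le> 4 - 1" if "W \<in> proj_subspaces (4 - 2)" for W
      using that card_plane_section_le[OF T(2), of W] T(2)
      by (simp add: points_in_proj_pt proj_subspaces_def)
  qed (use span five dimS proj_pt_points[OF T(2)] in \<open>simp_all add: proj_subspaces_def\<close>)
  moreover have "rs_set 5 3 ?X"
    unfolding rs_set_def
  proof (intro conjI ballI bexI[of _ ?H])
    show "points_in ?X W \<le> 5" if "W \<in> proj_subspaces 3" for W
      using that card_solid_section_le[OF T(2), of W] T(2)
      by (simp add: points_in_proj_pt proj_subspaces_def)
  qed (use span seven dimH proj_pt_points[OF T(2)] in \<open>simp_all add: proj_subspaces_def\<close>)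
  moreover have "card ?X = q ^ 2 - q"
    using card_image[OF inj_on_subset[OF inj_on_proj_pt T(2)]] T(3) by simp
  ultimately show ?thesis using affine_proj_pt[OF T(2)] by blast
qed

end
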